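(* Let $n\ge 1$ be an integer and $p\in[1,\infty)$. Fix $a,b,\alpha,\beta\in[0,\pi]$ with $a<\alpha$ and $b<\beta$. Set $$A:=\{x\in\mathbb{S}^n \mid d_{\mathbb{S}^n}(x,e_{n+1})\in(a,\alpha)\},\qquad \mu:=\frac{\mathbf{1}_A}{\mathrm{vol}_{\mathbb{S}^n}(A)}\,\mathrm{vol}_{\mathbb{S}^n},$$ $$B:=\{y\in\mathbb{S}^n \mid d_{\mathbb{S}^n}(y,-e_{n+1})\in(b,\beta)\},\qquad \nu:=\frac{\mathbf{1}_B}{\mathrm{vol}_{\mathbb{S}^n}(B)}\,\mathrm{vol}_{\mathbb{S}^n}.$$ Let $\varphi\in C([a,\alpha])\cap C^\infty((a,\alpha))$ be a strictly decreasing (real-valued) function satisfying $$\frac{1}{\mathrm{vol}_{\mathbb{S}^n}(A)}\int_a^\theta \sin^{n-1}r\,dr=\frac{1}{\mathrm{vol}_{\mathbb{S}^n}(B)}\int_{\varphi(\theta)}^\beta \sin^{n-1}r\,dr\qquad\text{for all }\theta\in(a,\alpha).$$ Then the map $T\colon A\to\mathbb{S}^n$ defined by $$T(x)=\frac{\sin\varphi(\theta_x)}{\sin\theta_x}\,x^\perp-\cos\varphi(\theta_x)\,e_{n+1}\qquad\text{for }x\in A$$ is a $p$-optimal transport map from $\mu$ to $\nu$.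
   Context: $\mathbb{S}^n\subset\mathbb{R}^{n+1}$ is the unit sphere with its standard round Riemannian metric; $d_{\mathbb{S}^n}$ is its Riemannian distance function (so $d_{\mathbb{S}^n}(x,y)=\arccos\langle x,y\rangle$, with $\langle\cdot,\cdot\rangle$ the Euclidean inner product) and $\mathrm{vol}_{\mathbb{S}^n}$ is its Riemannian volume measure. $(e_1,\dots,e_{n+1})$ is the natural basis of $\mathbb{R}^{n+1}$, and $\mathbf{1}_E$ is the characteristic function of a set $E$. For $z\in\mathbb{S}^n$, set $$\theta_z:=\arccos\langle z,e_{n+1}\rangle=d_{\mathbb{S}^n}(z,e_{n+1}),\qquad z^\perp:=z-\langle z,e_{n+1}\rangle e_{n+1}.$$ Pushforward: for Borel probability measures $\mu,\nu$ on $\mathbb{S}^n$, a Borel set $E\subset\mathbb{S}^n$ with $\mu(E)=1$, and a Borel map $T\colon E\to\mathbb{S}^n$, the expression $T_\sharp\mu=\nu$ means that $\int_{\mathbb{S}^n}h(y)\,d\nu(y)=\int_{\mathbb{S}^n}h(T(x))\,d\mu(x)$ for every bounded continuous function $h\colon\mathbb{S}^n\to\mathbb{R}$ (the right-hand integral is understood over $E$, which has full $\mu$-measure). $p$-optimal transport map: a Borel map $T$ defined on a Borel set of full $\mu$-measure, with values in $\mathbb{S}^n$, is a $p$-optimal transport map from $\mu$ to $\nu$ if $T_\sharp\mu=\nu$ and it attains the infimum in the Monge problem, i.e. $$\int_{\mathbb{S}^n}d_{\mathbb{S}^n}(x,T(x))^p\,d\mu(x)=\inf\left\{\int_{\mathbb{S}^n}d_{\mathbb{S}^n}(x,\widetilde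 T(x))^p\,d\mu(x)\;\middle|\;\widetilde T\colon\mathbb{S}^n\to\mathbb{S}^n\text{ is Borel with }\widetilde T_\sharp\mu=\nu\right\}.$$ *)

theory Defs
  imports "HOL-Probability.Probability"
begin

text \<open>
  \<open>\<real>\<^sup>n\<^sup>+\<^sup>1\<close> is rendered as \<open>\<real>\<^sup>n \<times> \<real>\<close>, i.e. as the type \<open>(real ^ 'n) \<times> real\<close> with
  \<open>n = CARD('n)\<close>; its library inner product and norm are the Euclidean ones. The second component
  is the last coordinate.
\<close>

abbreviation unit_sphere :: "((real ^ 'n) \<times> real) set" where
  "unit_sphere \<equiv> sphere 0 1"

definition e_last :: "(real ^ 'n) \<times> real" where
  "e_last = (0, 1)"

definition sphere_dist :: "(real ^ 'n) \<times> real \<Rightarrow> (real ^ 'n) \<times> real \<Rightarrow> real" where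
  "sphere_dist x y = arccos (x \<bullet> y)"

definition polar_angle :: "(real ^ 'n) \<times> real \<Rightarrow> real" where
  "polar_angle z = arccos (z \<bullet> e_last)"

definition perp :: "(real ^ 'n) \<times> real \<Rightarrow> (real ^ 'n) \<times> real" where
  "perp z = z - (z \<bullet> e_last) *\<^sub>R e_last"

definition sphere_borel :: "((real ^ 'n) \<times> real) measure" where
  "sphere_borel = restrict_space borel unit_sphere"

text \<open>
  The Riemannian volume measure. In a local parametrization \<open>f\<close> of a submanifold of Euclidean
  space, the induced metric has coefficients \<open>g\<^sub>i\<^sub>j = \<langle>\<partial>\<^sub>i f, \<partial>\<^sub>j f\<rangle>\<close> and the volume measure is
  \<open>sqrt (det g) du\<close>. The inverse stereographic projection parametrizes the whole sphere except
  the pole \<open>e_last\<close>, a single point and hence a null set (as \<open>n \<ge> 1\<close>), so this one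
  parametrization determines the volume measure.
\<close>

definition metric_coeffs :: "(real ^ 'n \<Rightarrow> 'b::real_inner) \<Rightarrow> real ^ 'n \<Rightarrow> real ^ 'n ^ 'n" where
  "metric_coeffs f u =
     (\<chi> i j. frechet_derivative f (at u) (axis i 1) \<bullet> frechet_derivative f (at u) (axis j 1))"

definition inv_stereographic :: "real ^ 'n \<Rightarrow> (real ^ 'n) \<times> real" where
  "inv_stereographic u =
     ((2 / ((norm u)\<^sup>2 + 1)) *\<^sub>R u, ((norm u)\<^sup>2 - 1) / ((norm u)\<^sup>2 + 1))"

definition vol_sphere :: "((real ^ 'n) \<times> real) measure" where
  "vol_sphere =
     distr (density lborel (\<lambda>u. ennreal (sqrt (det (metric_coeffs inv_stereographic u)))))
       sphere_borel inv_stereographic"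

definition borel_prob_on_sphere :: "((real ^ 'n) \<times> real) measure \<Rightarrow> bool" where
  "borel_prob_on_sphere \<mu> \<longleftrightarrow> prob_space \<mu> \<and> sets \<mu> = sets sphere_borel"

text \<open>Maps between spheres are total functions in HOL; the set \<open>E\<close> below is the domain of \<open>T\<close>,
  and only the values of \<open>T\<close> on \<open>E\<close> matter.\<close>

definition pushes_forward ::
  "((real ^ 'n) \<times> real) set \<Rightarrow> ((real ^ 'n) \<times> real \<Rightarrow> (real ^ 'n) \<times> real) \<Rightarrow>
     ((real ^ 'n) \<times> real) measure \<Rightarrow> ((real ^ 'n) \<times> real) measure \<Rightarrow> bool" where
  "pushes_forward E T \<mu> \<nu> \<longleftrightarrow>
     (\<forall>h :: (real ^ 'n) \<times> real \<Rightarrow> real.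
        continuous_on unit_sphere h \<longrightarrow> bounded (h ` unit_sphere) \<longrightarrow>
        (LINT y|\<nu>. h y) = (LINT x:E|\<mu>. h (T x)))"

definition transport_cost ::
  "real \<Rightarrow> ((real ^ 'n) \<times> real) measure \<Rightarrow> ((real ^ 'n) \<times> real) set \<Rightarrow>
     ((real ^ 'n) \<times> real \<Rightarrow> (real ^ 'n) \<times> real) \<Rightarrow> ennreal" where
  "transport_cost p \<mu> E T = (\<integral>\<^sup>+x\<in>E. ennreal (sphere_dist x (T x) powr p) \<partial>\<mu>)"

definition optimal_transport_map ::
  "real \<Rightarrow> ((real ^ 'n) \<times> real) measure \<Rightarrow> ((real ^ 'n) \<times> real) measure \<Rightarrow>
     ((real ^ 'n) \<times> real) set \<Rightarrow> ((real ^ 'n) \<times> real \<Rightarrow> (real ^ 'n) \<times> real) \<Rightarrow> bool" where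
  "optimal_transport_map p \<mu> \<nu> E T \<longleftrightarrow>
     borel_prob_on_sphere \<mu> \<and> borel_prob_on_sphere \<nu> \<and>
     E \<in> sets sphere_borel \<and> emeasure \<mu> E = 1 \<and>
     T \<in> measurable (restrict_space sphere_borel E) sphere_borel \<and>
     pushes_forward E T \<mu> \<nu> \<and>
     transport_cost p \<mu> E T =
       Inf {transport_cost p \<mu> unit_sphere S | S.
              S \<in> measurable sphere_borel sphere_borel \<and> pushes_forward unit_sphere S \<mu> \<nu>}"

definition smooth_on_open :: "real set \<Rightarrow> (real \<Rightarrow> real) \<Rightarrow> bool" where
  "smooth_on_open I f \<longleftrightarrow> open I \<and> (\<forall>k. \<forall>x\<in>I. ((deriv ^^ k) f) differentiable (at x))"

end

theory Submission
  imports Defs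
begin

text \<open>
The map \<open>T\<close> moves every point along its own meridian, and in the polar angle it is the increasing
map \<open>\<psi> = \<pi> - \<phi>\<close>. Two facts make it optimal.

The first is that the distance of two points is at least the difference of their polar angles, with
equality on a common meridian (\<open>polar_angle_diff_le_sphere_dist\<close>, \<open>sphere_dist_meridian\<close>). Hence
the cost of any competitor is at least the cost of transporting polar angles on the line, and for the
convex cost \<open>\<bar>s - t\<bar>\<^sup>p\<close> with \<open>p \<ge> 1\<close> the increasing rearrangement is optimal there. The
latter is proved by duality: \<open>monotone_dual_potentials\<close> gives continuous \<open>f\<close> and \<open>g\<close> with
\<open>f s + g t \<le> \<bar>s - t\<bar>\<^sup>p\<close>, and equality for \<open>t = \<psi> s\<close>. Composed with the polar angle they are
potentials on the sphere, whose integrals depend on \<open>\<mu>\<close> and \<open>\<nu>\<close> only; so they bound every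
competitor from below by the cost of \<open>T\<close> (\<open>optimal_transport_map_by_duality\<close>).

The second is that \<open>T\<close> does push \<open>\<mu>\<close> forward to \<open>\<nu>\<close>. In the coordinates given by the polar angle
and the direction of the meridian, the volume is the product of \<open>sin\<^sup>n\<^sup>-\<^sup>1 \<theta> d\<theta>\<close> with a measure
on directions (\<open>emeasure_vol_sphere_rectangle\<close>). As \<open>T\<close> fixes the direction, only the polar
angles matter, and for these the integral equation for \<open>\<phi>\<close> is the required equality of distribution
functions (\<open>polar_measure_transport\<close>).

The product form of the volume is read off from the stereographic parametrization, whose volume
density depends on the radius only: by homogeneity, Lebesgue measure of a cone over a set of
directions grows like \<open>r\<^sup>n\<close>, and \<open>\<theta> = \<pi> - 2 arctan r\<close> turns the resulting density in \<open>r\<close>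
into \<open>sin\<^sup>n\<^sup>-\<^sup>1 \<theta>\<close>.

The values of \<open>\<phi>\<close> are arbitrary reals, and for even \<open>n\<close> the integral of \<open>sin\<^sup>n\<^sup>-\<^sup>1\<close> is periodic, so
\<open>\<phi>\<close> is determined by its equation only up to a multiple of \<open>2\<pi>\<close>, which leaves \<open>T\<close> unchanged
(\<open>mass_balance_normalization\<close>).
\<close>

section \<open>Meridians and polar angles\<close>

definition sphere_coords :: "(real ^ 'n) \<times> real \<Rightarrow> real \<times> (real ^ 'n)" where
  "sphere_coords x = (polar_angle x, sgn (fst x))"

definition meridian_point :: "real \<Rightarrow> real ^ 'n \<Rightarrow> (real ^ 'n) \<times> real" where
  "meridian_point \<theta> \<omega> = (sin \<theta> *\<^sub>R \<omega>, cos \<theta>)"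

lemma polar_angle_eq_arccos: "polar_angle x = arccos (snd x)"
  by (cases x) (simp add: polar_angle_def e_last_def)

lemma perp_eq: "perp x = (fst x, 0)"
  by (cases x) (simp add: perp_def e_last_def)

lemma snd_sphere_bounds: "x \<in> unit_sphere \<Longrightarrow> \<bar>snd x\<bar> \<le> 1"
  using norm_snd_le[of "snd x" "fst x"] by simp

lemma polar_angle_bounds:
  assumes "x \<in> unit_sphere"
  shows "0 \<le> polar_angle x" "polar_angle x \<le> pi"
  using snd_sphere_bounds[OF assms]
  by (auto simp: polar_angle_eq_arccos intro!: arccos_lbound arccos_ubound)

lemma snd_sphere: "x \<in> unit_sphere \<Longrightarrow> snd x = cos (polar_angle x)"
  using snd_sphere_bounds[of x] by (simp add: polar_angle_eq_arccos cos_arccos_abs)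

lemma norm_fst_sphere:
  assumes "x \<in> unit_sphere"
  shows "norm (fst x) = sin (polar_angle x)"
proof -
  have "(norm (fst x))\<^sup>2 + (snd x)\<^sup>2 = 1"
    using assms by (cases x) (simp add: norm_Pair)
  then have "(norm (fst x))\<^sup>2 = (sin (polar_angle x))\<^sup>2"
    using snd_sphere[OF assms] by (simp add: sin_squared_eq)
  moreover have "0 \<le> sin (polar_angle x)"
    using polar_angle_bounds[OF assms] by (intro sin_ge_zero)
  ultimately show ?thesis
    by (simp add: power2_eq_iff_nonneg)
qed

text \<open>
This also holds at the two poles, where the direction is \<open>sgn 0 = 0\<close> but is multiplied by
\<open>sin \<theta> = 0\<close>. So the coordinates are injective on the whole sphere.
\<close>

lemma meridian_point_sphere_coords:
  assumes "x \<in> unit_sphere"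
  shows "meridian_point (polar_angle x) (sgn (fst x)) = x"
  using snd_sphere[OF assms] norm_fst_sphere[OF assms, symmetric]
  by (cases x; cases "fst x = 0") (simp_all add: meridian_point_def sgn_div_norm)

text \<open>
The inner product is largest when both points lie on the same meridian: this is the Cauchy-Schwarz
inequality for their horizontal parts.
\<close>

lemma inner_sphere_le_cos_diff:
  assumes "x \<in> unit_sphere" "y \<in> unit_sphere"
  shows "x \<bullet> y \<le> cos (polar_angle x - polar_angle y)"
proof -
  have "fst x \<bullet> fst y \<le> norm (fst x) * norm (fst y)"
    by (rule norm_cauchy_schwarz)
  then have "x \<bullet> y \<le> sin (polar_angle x) * sin (polar_angle y)
                 + cos (polar_angle x) * cos (polar_angle y)"
    using snd_sphere[OF assms(1)] snd_sphere[OF assms(2)]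
      norm_fst_sphere[OF assms(1)] norm_fst_sphere[OF assms(2)]
    by (cases x, cases y) simp
  then show ?thesis by (simp add: cos_diff)
qed

lemma polar_angle_diff_le_sphere_dist:
  assumes "x \<in> unit_sphere" "y \<in> unit_sphere"
  shows "\<bar>polar_angle x - polar_angle y\<bar> \<le> sphere_dist x y"
proof -
  let ?d = "\<bar>polar_angle x - polar_angle y\<bar>"
  have d: "0 \<le> ?d" "?d \<le> pi"
    using polar_angle_bounds[OF assms(1)] polar_angle_bounds[OF assms(2)] by auto
  have ip: "\<bar>x \<bullet> y\<bar> \<le> 1"
    using Cauchy_Schwarz_ineq2[of x y] assms by simp
  have "x \<bullet> y \<le> cos ?d"
    using inner_sphere_le_cos_diff[OF assms] by (simp add: cos_abs_real)
  then have "arccos (cos ?d) \<le> arccos (x \<bullet> y)"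
    using ip by (intro arccos_le_arccos) auto
  then show ?thesis
    unfolding sphere_dist_def arccos_cos[OF d] .
qed

lemma meridian_point_in_sphere:
  assumes "norm \<omega> = 1" shows "meridian_point \<theta> \<omega> \<in> unit_sphere"
  using assms by (simp add: meridian_point_def norm_Pair)

lemma polar_angle_meridian_point:
  assumes "0 \<le> \<theta>" "\<theta> \<le> pi" shows "polar_angle (meridian_point \<theta> \<omega>) = \<theta>"
  using assms by (simp add: polar_angle_eq_arccos meridian_point_def arccos_cos)

lemma sgn_fst_meridian_point:
  assumes "0 < \<theta>" "\<theta> < pi" "norm \<omega> = 1" shows "sgn (fst (meridian_point \<theta> \<omega>)) = \<omega>"
  using assms sin_gt_zero[of \<theta>] by (simp add: meridian_point_def sgn_div_norm)

lemma sphere_dist_meridian: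
  assumes "norm \<omega> = 1" "\<theta> \<in> {0..pi}" "\<eta> \<in> {0..pi}"
  shows "sphere_dist (meridian_point \<theta> \<omega>) (meridian_point \<eta> \<omega>) = \<bar>\<theta> - \<eta>\<bar>"
proof -
  have "\<omega> \<bullet> \<omega> = 1" using assms(1) by (simp add: dot_square_norm)
  then have "meridian_point \<theta> \<omega> \<bullet> meridian_point \<eta> \<omega> = cos \<bar>\<theta> - \<eta>\<bar>"
    by (simp add: meridian_point_def cos_diff cos_abs_real)
  moreover have "0 \<le> \<bar>\<theta> - \<eta>\<bar>" "\<bar>\<theta> - \<eta>\<bar> \<le> pi" using assms by auto
  ultimately show ?thesis by (simp only: sphere_dist_def arccos_cos)
qed

lemma sphere_dist_uminus_e_last:
  assumes "x \<in> unit_sphere"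
  shows "sphere_dist x (- e_last) = pi - polar_angle x"
  using snd_sphere_bounds[OF assms]
  by (cases x) (simp add: sphere_dist_def polar_angle_def e_last_def arccos_minus_abs)

section \<open>The volume density in stereographic coordinates\<close>

lemma polar_angle_inv_stereographic:
  "polar_angle (inv_stereographic u) = pi - 2 * arctan (norm u)"
proof -
  let ?r = "norm u"
  have "cos (pi - 2 * arctan ?r) = - cos (2 * arctan ?r)"
    by (simp add: cos_diff)
  also have "cos (2 * arctan ?r) = 2 * (cos (arctan ?r))\<^sup>2 - 1"
    by (rule cos_double_cos)
  also have "(cos (arctan ?r))\<^sup>2 = 1 / (1 + ?r\<^sup>2)"
    by (simp add: cos_arctan power_divide)
  also have "- (2 * (1 / (1 + ?r\<^sup>2)) - 1) = (?r\<^sup>2 - 1) / (?r\<^sup>2 + 1)"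
  proof -
    have "?r\<^sup>2 + 1 > 0" by (smt (verit) zero_le_power2)
    then show ?thesis by (simp add: field_simps)
  qed
  finally have c: "snd (inv_stereographic u) = cos (pi - 2 * arctan ?r)"
    by (simp add: inv_stereographic_def)
  have "0 \<le> pi - 2 * arctan ?r" "pi - 2 * arctan ?r \<le> pi"
    using arctan_ubound[of ?r] by (auto simp: )
  then show ?thesis
    by (simp only: polar_angle_eq_arccos c arccos_cos)
qed

lemma sgn_fst_inv_stereographic: "sgn (fst (inv_stereographic u)) = sgn u"
proof -
  have "(norm u)\<^sup>2 + 1 > 0" by (smt (verit) zero_le_power2)
  then show ?thesis by (simp add: inv_stereographic_def sgn_scaleR)
qed

lemma inv_stereographic_in_sphere: "inv_stereographic u \<in> unit_sphere"
proof -
  define s where "s = (norm u)\<^sup>2"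
  have s: "s + 1 > 0" unfolding s_def by (smt (verit) zero_le_power2)
  have "(norm (inv_stereographic u))\<^sup>2 = (2 / (s + 1))\<^sup>2 * s + ((s - 1) / (s + 1))\<^sup>2"
    by (simp add: inv_stereographic_def norm_Pair power_mult_distrib s_def power_divide)
  also have "\<dots> = 1"
  proof -
    have "(2 / (s + 1))\<^sup>2 * s + ((s - 1) / (s + 1))\<^sup>2 = (4 * s + (s - 1)\<^sup>2) / (s + 1)\<^sup>2"
      by (simp add: power_divide add_divide_distrib)
    also have "4 * s + (s - 1)\<^sup>2 = (s + 1)\<^sup>2" by (simp add: power2_eq_square algebra_simps)
    finally show ?thesis using s by simp
  qed
  finally show ?thesis by (simp add: abs_square_eq_1)
qed

lemma inv_stereographic_has_derivative:
  fixes u :: "real ^ 'n"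
  defines "q \<equiv> 2 / ((norm u)\<^sup>2 + 1)"
  shows "(inv_stereographic has_derivative
           (\<lambda>v. (q *\<^sub>R v - (q\<^sup>2 * (u \<bullet> v)) *\<^sub>R u, q\<^sup>2 * (u \<bullet> v)))) (at u)"
proof -
  have pos: "u \<bullet> u + 1 > 0" for u :: "real ^ 'n" by (smt (verit) inner_ge_zero)
  have q: "q = 2 / (u \<bullet> u + 1)" by (simp add: q_def dot_square_norm)
  have eq: "inv_stereographic = (\<lambda>u :: real ^ 'n. ((2 / (u \<bullet> u + 1)) *\<^sub>R u, 1 - 2 / (u \<bullet> u + 1)))"
  proof
    fix v :: "real ^ 'n"
    show "inv_stereographic v = ((2 / (v \<bullet> v + 1)) *\<^sub>R v, 1 - 2 / (v \<bullet> v + 1))"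
      using pos[of v] by (simp add: inv_stereographic_def dot_square_norm[symmetric] field_simps)
  qed
  have dq: "((\<lambda>u :: real ^ 'n. 2 / (u \<bullet> u + 1)) has_derivative (\<lambda>v. - (q\<^sup>2 * (u \<bullet> v)))) (at u)"
    unfolding q using pos[of u]
    by (auto intro!: derivative_eq_intros ext
        simp: power2_eq_square field_simps inner_commute)
  show ?thesis
    unfolding eq
    by (rule has_derivative_eq_rhs, rule has_derivative_Pair,
        rule has_derivative_scaleR[OF dq has_derivative_ident],
        rule has_derivative_diff[OF has_derivative_const dq])
       (simp add: q[symmetric])
qed

text \<open>
Stereographic projection is conformal. With \<open>q = 2 / (\<bar>u\<bar>\<^sup>2 + 1)\<close>, the terms of
\<open>\<langle>D v, D w\<rangle> - q\<^sup>2 \<langle>v, w\<rangle>\<close> share the factor \<open>q (\<bar>u\<bar>\<^sup>2 + 1) - 2 = 0\<close>.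
\<close>

lemma metric_coeffs_inv_stereographic:
  fixes u :: "real ^ 'n"
  shows "metric_coeffs inv_stereographic u = mat ((2 / ((norm u)\<^sup>2 + 1))\<^sup>2)"
proof -
  define q where "q = 2 / ((norm u)\<^sup>2 + 1)"
  have pos: "(norm u)\<^sup>2 + 1 > 0" by (smt (verit) zero_le_power2)
  have n: "q * (u \<bullet> u + 1) = 2" using pos by (simp add: q_def dot_square_norm field_simps)
  have fd: "frechet_derivative inv_stereographic (at u) =
      (\<lambda>v. (q *\<^sub>R v - (q\<^sup>2 * (u \<bullet> v)) *\<^sub>R u, q\<^sup>2 * (u \<bullet> v)))"
    unfolding q_def by (rule frechet_derivative_at[OF inv_stereographic_has_derivative, symmetric])
  have "(q *\<^sub>R v - (q\<^sup>2 * (u \<bullet> v)) *\<^sub>R u, q\<^sup>2 * (u \<bullet> v)) \<bullet> (q *\<^sub>R w - (q\<^sup>2 * (u \<bullet> w)) *\<^sub>R u, q\<^sup>2 * (u \<bullet> w))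
      = q\<^sup>2 * (v \<bullet> w)" for v w
  proof -
    have "(q *\<^sub>R v - (q\<^sup>2 * (u \<bullet> v)) *\<^sub>R u, q\<^sup>2 * (u \<bullet> v)) \<bullet> (q *\<^sub>R w - (q\<^sup>2 * (u \<bullet> w)) *\<^sub>R u, q\<^sup>2 * (u \<bullet> w))
      = q\<^sup>2 * (v \<bullet> w) + q^3 * (u \<bullet> v) * (u \<bullet> w) * (q * (u \<bullet> u + 1) - 2)"
      by (simp add: inner_diff_left inner_diff_right inner_commute algebra_simps power2_eq_square power3_eq_cube)
    then show ?thesis by (simp only: n) simp
  qed
  then have "metric_coeffs inv_stereographic u = (\<chi> i j. q\<^sup>2 * (axis i 1 \<bullet> (axis j 1 :: real ^ 'n)))"
    unfolding metric_coeffs_def fd by presburger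
  also have "\<dots> = mat (q\<^sup>2)"
    by (simp add: mat_def vec_eq_iff inner_axis_axis)
  finally show ?thesis by (simp add: q_def)
qed

lemma sqrt_det_metric_coeffs:
  fixes u :: "real ^ 'n"
  shows "sqrt (det (metric_coeffs inv_stereographic u)) = (2 / ((norm u)\<^sup>2 + 1)) ^ CARD('n)"
proof -
  define q where "q = 2 / ((norm u)\<^sup>2 + 1)"
  have q: "q \<ge> 0" by (simp add: q_def add_nonneg_nonneg)
  have "det (mat (q\<^sup>2) :: real ^ 'n ^ 'n) = (q\<^sup>2) ^ CARD('n)"
    by (subst det_diagonal) (auto simp: mat_def)
  also have "\<dots> = (q ^ CARD('n))\<^sup>2" by (simp flip: power_mult add: mult.commute)
  finally show ?thesis using q by (simp add: metric_coeffs_inv_stereographic q_def[symmetric])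
qed

section \<open>Radial integrals over cones\<close>

lemma measure_eqI_atMost:
  fixes M N :: "real measure"
  assumes sets: "sets M = sets borel" "sets N = sets borel"
  assumes fin: "\<And>x. emeasure M {..x} < \<infinity>"
  assumes eq: "\<And>x. emeasure M {..x} = emeasure N {..x}"
  shows "M = N"
proof (rule measure_eqI_generator_eq[where E = "range atMost" and \<Omega> = UNIV
        and A = "\<lambda>i::nat. {..real i}"])
  show "Int_stable (range atMost :: real set set)"
    by (auto simp: Int_stable_def intro!: rangeI)
  have "sets borel = sigma_sets UNIV (range atMost :: real set set)"
    unfolding borel_eq_atMost by simp
  then show "sets M = sigma_sets UNIV (range atMost)" "sets N = sigma_sets UNIV (range atMost)"
    using sets by simp_all
  show "(\<Union>i::nat. {..real i}) = UNIV"
    using real_arch_simple by auto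
qed (use eq fin in \<open>auto simp: less_top\<close>)

definition cone_volume :: "'a::euclidean_space set \<Rightarrow> ennreal" where
  "cone_volume \<Omega> = emeasure lborel {u. norm u \<le> 1 \<and> sgn u \<in> \<Omega>}"

lemma borel_measurable_sgn_euclidean [measurable]:
  "(sgn :: 'a::euclidean_space \<Rightarrow> 'a) \<in> borel_measurable borel"
  unfolding sgn_div_norm[abs_def] by measurable

lemma cone_volume_finite: "cone_volume (\<Omega> :: 'a::euclidean_space set) < \<infinity>"
proof -
  have "cone_volume \<Omega> \<le> emeasure lborel (cball (0::'a) 1)"
    unfolding cone_volume_def by (intro emeasure_mono) auto
  then show ?thesis
    using emeasure_bounded_finite[OF bounded_cball] by (rule le_less_trans)
qed

lemma cone_volume_UNIV_pos: "0 < cone_volume (UNIV :: 'a::euclidean_space set)"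
proof -
  have "0 < emeasure lborel (ball (0::'a) 1)"
    using emeasure_lborel_ball_finite[of "0::'a" 1] content_ball_pos[of 1 "0::'a"]
    by (simp add: emeasure_eq_ennreal_measure)
  also have "\<dots> \<le> cone_volume (UNIV :: 'a set)"
    unfolding cone_volume_def by (intro emeasure_mono) auto
  finally show ?thesis .
qed

text \<open>
A cone is invariant under dilations, which multiply Lebesgue measure by \<open>t\<^sup>n\<close>.
\<close>

lemma emeasure_cone_cball:
  fixes \<Omega> :: "'a::euclidean_space set"
  assumes [measurable]: "\<Omega> \<in> sets borel" and t: "0 < t"
  shows "emeasure lborel {u. norm u \<le> t \<and> sgn u \<in> \<Omega>} = ennreal (t ^ DIM('a)) * cone_volume \<Omega>"
proof -
  let ?S = "{u. norm u \<le> t \<and> sgn u \<in> \<Omega>}"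
  have "emeasure lborel ?S
      = emeasure (density (distr lborel borel (\<lambda>x. 0 + t *\<^sub>R x)) (\<lambda>_. \<bar>t\<bar> ^ DIM('a))) ?S"
    using t by (subst lborel_affine[of t "0::'a"]) auto
  also have "\<dots> = ennreal (t ^ DIM('a)) * emeasure (distr lborel borel (\<lambda>x. t *\<^sub>R x)) ?S"
    using t by (subst emeasure_density_const) auto
  also have "emeasure (distr lborel borel (\<lambda>x. t *\<^sub>R x)) ?S = cone_volume \<Omega>"
    using t unfolding cone_volume_def
    by (subst emeasure_distr) (auto intro!: arg_cong[where f="emeasure lborel"] simp: sgn_scaleR)
  finally show ?thesis .
qed

text \<open>
Polar integration for radial integrands over a cone. The scaling law gives the distribution of the
norm on the cone on every \<open>{..t}\<close>, and its density is the derivative of \<open>t\<^sup>n\<close>.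
\<close>

lemma nn_integral_cone:
  fixes \<Omega> :: "'a::euclidean_space set" and k :: "real \<Rightarrow> ennreal"
  assumes [measurable]: "\<Omega> \<in> sets borel" "k \<in> borel_measurable borel"
  shows "(\<integral>\<^sup>+u. k (norm u) * indicator \<Omega> (sgn u) \<partial>lborel)
       = cone_volume \<Omega> *
         (\<integral>\<^sup>+r. k r * (ennreal (real DIM('a) * r ^ (DIM('a) - 1)) * indicator {0..} r) \<partial>lborel)"
proof -
  let ?n = "DIM('a)"
  let ?M = "distr (density lborel (\<lambda>u. indicator \<Omega> (sgn u))) borel (norm :: 'a \<Rightarrow> real)"
  let ?N = "density lborel
              (\<lambda>r. cone_volume \<Omega> * (ennreal (real ?n * r ^ (?n - 1)) * indicator {0..} r))"
  have M: "emeasure ?M {..t} = (if t \<le> 0 then 0 else ennreal (t ^ ?n) * cone_volume \<Omega>)" for t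
  proof -
    have pre: "norm -` {..t} = {u::'a. norm u \<le> t}" by auto
    have "emeasure ?M {..t} = (\<integral>\<^sup>+u. indicator \<Omega> (sgn u) * indicator {u. norm u \<le> t} u \<partial>lborel)"
      by (subst emeasure_distr, simp, simp, subst emeasure_density) (simp_all add: pre)
    also have "\<dots> = (\<integral>\<^sup>+u. indicator {u. norm u \<le> t \<and> sgn u \<in> \<Omega>} u \<partial>lborel)"
      by (intro nn_integral_cong) (auto simp: indicator_def)
    also have "\<dots> = emeasure lborel {u. norm u \<le> t \<and> sgn u \<in> \<Omega>}"
      by (rule nn_integral_indicator) simp
    also have "\<dots> = (if t \<le> 0 then 0 else ennreal (t ^ ?n) * cone_volume \<Omega>)"
    proof (cases "t \<le> 0")
      case True
      then have "{u. norm u \<le> t \<and> sgn u \<in> \<Omega>} \<subseteq> {0::'a}"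
        by (auto dest: order_trans)
      then have "emeasure lborel {u. norm u \<le> t \<and> sgn u \<in> \<Omega>} \<le> emeasure lborel {0::'a}"
        by (intro emeasure_mono) auto
      then show ?thesis using True by simp
    qed (simp add: emeasure_cone_cball)
    finally show ?thesis .
  qed
  have N: "emeasure ?N {..t} = (if t \<le> 0 then 0 else ennreal (t ^ ?n) * cone_volume \<Omega>)" for t
  proof -
    have "emeasure ?N {..t} = cone_volume \<Omega> *
        (\<integral>\<^sup>+r. ennreal (real ?n * r ^ (?n - 1)) * indicator {0..t} r \<partial>lborel)"
      by (subst emeasure_density)
         (auto intro!: nn_integral_cong simp: indicator_def ac_simps nn_integral_cmult[symmetric])
    also have "(\<integral>\<^sup>+r. ennreal (real ?n * r ^ (?n - 1)) * indicator {0..t} r \<partial>lborel)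
        = (if t \<le> 0 then 0 else ennreal (t ^ ?n))"
    proof (cases "t \<le> 0")
      case True
      have "AE r in lborel. ennreal (real ?n * r ^ (?n - 1)) * indicator {0..t} r = 0"
        using AE_lborel_singleton[of "0::real"] by eventually_elim (use True in \<open>auto simp: indicator_def\<close>)
      then have "(\<integral>\<^sup>+r. ennreal (real ?n * r ^ (?n - 1)) * indicator {0..t} r \<partial>lborel) = 0"
        by (subst nn_integral_0_iff_AE) auto
      then show ?thesis using True by simp
    next
      case False
      have "(\<integral>\<^sup>+r. ennreal (real ?n * r ^ (?n - 1)) * indicator {0..t} r \<partial>lborel)
          = ennreal (t ^ ?n - 0 ^ ?n)"
        using False by (intro nn_integral_FTC_Icc) (auto intro!: derivative_eq_intros)
      then show ?thesis using False by (simp add: power_0_left)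
    qed
    finally show ?thesis by (simp add: mult.commute)
  qed
  have "?M = ?N"
  proof (rule measure_eqI_atMost)
    show "emeasure ?M {..x} < \<infinity>" for x
      unfolding M using cone_volume_finite[of \<Omega>] by (simp add: ennreal_mult_less_top)
  qed (simp_all only: M N sets_distr sets_density sets_lborel)
  then have "(\<integral>\<^sup>+r. k r \<partial>?M) = (\<integral>\<^sup>+r. k r \<partial>?N)" by simp
  moreover have "(\<integral>\<^sup>+r. k r \<partial>?M) = (\<integral>\<^sup>+u. k (norm u) * indicator \<Omega> (sgn u) \<partial>lborel)"
    by (subst nn_integral_distr, simp, simp, subst nn_integral_density) (simp_all add: mult.commute)
  moreover have "(\<integral>\<^sup>+r. k r \<partial>?N) = cone_volume \<Omega> *
         (\<integral>\<^sup>+r. k r * (ennreal (real ?n * r ^ (?n - 1)) * indicator {0..} r) \<partial>lborel)"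
    by (subst nn_integral_density, simp, simp)
       (subst nn_integral_cmult[symmetric], auto intro!: nn_integral_cong simp: ac_simps)
  ultimately show ?thesis by simp
qed

section \<open>Primitives of powers of the sine\<close>

definition sin_primitive :: "nat \<Rightarrow> real \<Rightarrow> real" where
  "sin_primitive m t = (LBINT r=0..t. sin r ^ m)"

lemma sin_power_interval_integrable:
  "interval_lebesgue_integrable lborel (ereal x) (ereal y) (\<lambda>r. sin r ^ m)"
  by (rule interval_integrable_isCont) auto

lemma LBINT_sin_power:
  "(LBINT r=ereal x..ereal y. sin r ^ m) = sin_primitive m y - sin_primitive m x"
proof -
  have "(LBINT r=ereal 0..ereal x. sin r ^ m) + (LBINT r=ereal x..ereal y. sin r ^ m)
      = (LBINT r=ereal 0..ereal y. sin r ^ m)"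
    by (rule interval_integral_sum) (auto simp: min_def max_def sin_power_interval_integrable)
  then show ?thesis by (simp add: sin_primitive_def zero_ereal_def)
qed

lemma sin_primitive_0 [simp]: "sin_primitive m 0 = 0"
  by (simp add: sin_primitive_def zero_ereal_def)

lemma DERIV_sin_primitive: "(sin_primitive m has_real_derivative sin t ^ m) (at t)"
proof -
  have "((\<lambda>u. LBINT r=ereal (t - 1)..ereal u. sin r ^ m) has_vector_derivative sin t ^ m) (at t within {t - 1..t + 1})"
    by (rule interval_integral_FTC2) (auto intro!: continuous_intros)
  then have "((\<lambda>u. sin_primitive m u - sin_primitive m (t - 1)) has_real_derivative sin t ^ m)
      (at t within {t - 1..t + 1})"
    unfolding LBINT_sin_power by (simp add: has_real_derivative_iff_has_vector_derivative)
  then have "((\<lambda>u. sin_primitive m u - sin_primitive m (t - 1)) has_real_derivative sin t ^ m) (at t)"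
    by (subst (asm) at_within_interior) (auto simp: interior_atLeastAtMost_real)
  then have "((\<lambda>u. sin_primitive m u - sin_primitive m (t - 1) + sin_primitive m (t - 1))
      has_real_derivative sin t ^ m + 0) (at t)"
    by (intro DERIV_add) auto
  then show ?thesis by simp
qed

lemma continuous_on_sin_primitive: "continuous_on S (sin_primitive m)"
  by (rule DERIV_continuous_on, rule has_field_derivative_at_within, rule DERIV_sin_primitive)

text \<open>
The derivative \<open>sin\<^sup>m\<close> is nonnegative for even \<open>m\<close>, and if the primitive took the same value at two
points, then the sine would vanish on the whole interval between them.
\<close>

lemma sin_primitive_strict_mono_even:
  assumes "even m" "x < y"
  shows "sin_primitive m x < sin_primitive m y"
proof -
  have mono: "sin_primitive m u \<le> sin_primitive m v" if "u \<le> v" for u v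
    using that
  proof (rule DERIV_nonneg_imp_nondecreasing)
    show "\<exists>d. (sin_primitive m has_real_derivative d) (at z) \<and> 0 \<le> d" for z
      by (rule exI[of _ "sin z ^ m"]) (use assms(1) in \<open>auto intro!: DERIV_sin_primitive zero_le_even_power\<close>)
  qed
  have "sin_primitive m x \<noteq> sin_primitive m y"
  proof
    assume eq: "sin_primitive m x = sin_primitive m y"
    have zero: "sin z = 0" if z: "x < z" "z < y" for z
    proof -
      have "sin_primitive m z = sin_primitive m w" if "\<bar>z - w\<bar> < min (z - x) (y - z)" for w
      proof -
        have "x \<le> w" "w \<le> y" using that by auto
        then show ?thesis using z mono[of x z] mono[of z y] mono[of x w] mono[of w y] eq by auto
      qed
      then have "sin z ^ m = 0"
        using z by (intro DERIV_local_const[OF DERIV_sin_primitive[of m z], of "min (z - x) (y - z)"]) auto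
      then show ?thesis by simp
    qed
    define e where "e = min (y - x) pi / 3"
    have e: "0 < e" "2 * e < y - x" "e < pi"
      using assms(2) pi_gt_zero by (auto simp: e_def min_def)
    have "sin (x + 2 * e) = 0" "sin (x + e) = 0" using e by (auto intro!: zero)
    then have "sin ((x + 2 * e) - (x + e)) = 0" by (simp only: sin_diff)
    moreover have "(x + 2 * e) - (x + e) = e" by simp
    ultimately have "sin e = 0" by simp
    then show False using e sin_gt_zero[of e] by simp
  qed
  then show ?thesis using mono[of x y] assms(2) by simp
qed

lemma sin_primitive_strict_mono:
  assumes "0 \<le> x" "x < y" "y \<le> pi"
  shows "sin_primitive m x < sin_primitive m y"
proof (rule DERIV_pos_imp_increasing_open[OF assms(2)])
  show "\<exists>d. (sin_primitive m has_real_derivative d) (at z) \<and> 0 < d" if "x < z" "z < y" for z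
    by (rule exI[of _ "sin z ^ m"])
       (use that assms in \<open>auto intro!: DERIV_sin_primitive zero_less_power sin_gt_zero\<close>)
qed (rule continuous_on_sin_primitive)

lemma sin_primitive_inj:
  assumes "x \<in> {0..pi}" "y \<in> {0..pi}" "sin_primitive m x = sin_primitive m y"
  shows "x = y"
  using sin_primitive_strict_mono[of x y m] sin_primitive_strict_mono[of y x m] assms
  by (cases x y rule: linorder_cases) auto

text \<open>
For odd \<open>m\<close> the integrand is odd, so the primitive is even, and this makes the integral over a full
period vanish.
\<close>

lemma sin_primitive_uminus_odd:
  assumes "odd m" shows "sin_primitive m (- t) = sin_primitive m t"
proof -
  have D: "((\<lambda>t. sin_primitive m (- t) - sin_primitive m t) has_real_derivative 0) (at t)" for t
  proof -
    have "((\<lambda>t. sin_primitive m (- t) - sin_primitive m t) has_real_derivative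
        sin (- t) ^ m * (- 1) - sin t ^ m) (at t)"
      by (intro DERIV_diff DERIV_chain2[OF DERIV_sin_primitive] DERIV_sin_primitive)
         (auto intro!: derivative_eq_intros)
    then show ?thesis using assms by simp
  qed
  have "sin_primitive m (- t) - sin_primitive m t = sin_primitive m (- 0) - sin_primitive m 0"
    by (rule DERIV_isconst_all) (use D in blast)
  then show ?thesis by simp
qed

lemma sin_add_2pi_int: "sin (t + 2 * pi * of_int k) = sin t"
  by (simp add: sin_add)

lemma cos_add_2pi_int: "cos (t + 2 * pi * of_int k) = cos t"
  by (simp add: cos_add)

lemma sin_primitive_periodic_odd:
  assumes "odd m" shows "sin_primitive m (t + 2 * pi * of_int k) = sin_primitive m t"
proof -
  \<comment> \<open>The difference below is constant; evaluating it at \<open>-\<pi>k\<close> reduces the claim to evenness.\<close>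
  let ?c = "2 * pi * of_int k"
  have D: "((\<lambda>t. sin_primitive m (t + ?c) - sin_primitive m t) has_real_derivative 0) (at t)" for t
  proof -
    have "((\<lambda>t. sin_primitive m (t + ?c) - sin_primitive m t) has_real_derivative
        sin (t + ?c) ^ m * 1 - sin t ^ m) (at t)"
      by (intro DERIV_diff DERIV_chain2[OF DERIV_sin_primitive] DERIV_sin_primitive)
         (auto intro!: derivative_eq_intros)
    then show ?thesis by (simp only: sin_add_2pi_int) simp
  qed
  have "sin_primitive m (t + ?c) - sin_primitive m t
      = sin_primitive m (- (pi * of_int k) + ?c) - sin_primitive m (- (pi * of_int k))"
    by (rule DERIV_isconst_all) (use D in blast)
  also have "- (pi * of_int k) + ?c = pi * of_int k" by simp
  finally show ?thesis by (simp add: sin_primitive_uminus_odd[OF assms])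
qed

lemma sin_primitive_pi_minus:
  "sin_primitive m (pi - t) = sin_primitive m pi - sin_primitive m t"
proof -
  have D: "((\<lambda>t. sin_primitive m (pi - t) + sin_primitive m t) has_real_derivative 0) (at t)" for t
  proof -
    have "((\<lambda>t. sin_primitive m (pi - t) + sin_primitive m t) has_real_derivative
        sin (pi - t) ^ m * (- 1) + sin t ^ m) (at t)"
      by (intro DERIV_add DERIV_chain2[OF DERIV_sin_primitive] DERIV_sin_primitive)
         (auto intro!: derivative_eq_intros)
    then show ?thesis by simp
  qed
  have "sin_primitive m (pi - t) + sin_primitive m t = sin_primitive m (pi - 0) + sin_primitive m 0"
    by (rule DERIV_isconst_all) (use D in blast)
  then show ?thesis by simp
qed

section \<open>The volume of the sphere in polar coordinates\<close>

definition polar_measure :: "nat \<Rightarrow> real measure" where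
  "polar_measure m = density lborel (\<lambda>\<theta>. ennreal (sin \<theta> ^ m) * indicator {0..pi} \<theta>)"

lemma sets_polar_measure [measurable_cong, simp]: "sets (polar_measure m) = sets borel"
  by (simp add: polar_measure_def)

lemma emeasure_polar_measure:
  assumes "X \<in> sets borel"
  shows "emeasure (polar_measure m) X
       = (\<integral>\<^sup>+\<theta>. ennreal (sin \<theta> ^ m) * indicator {0..pi} \<theta> * indicator X \<theta> \<partial>lborel)"
  using assms unfolding polar_measure_def by (subst emeasure_density) simp_all

text \<open>
End points have measure zero and the measure is concentrated on \<open>[0, \<pi>]\<close>, so one statement serves
for open, closed and half-open intervals and for half-lines.
\<close>

lemma emeasure_polar_measure_interval:
  assumes "0 \<le> s" "s \<le> t" "t \<le> pi" "X \<in> sets borel"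
    and "{s<..<t} \<subseteq> X" "X \<inter> {0..pi} \<subseteq> {s..t}"
  shows "emeasure (polar_measure m) X = ennreal (sin_primitive m t - sin_primitive m s)"
proof -
  have "emeasure (polar_measure m) X
      = (\<integral>\<^sup>+\<theta>. ennreal (sin \<theta> ^ m) * indicator {s..t} \<theta> \<partial>lborel)"
    unfolding emeasure_polar_measure[OF assms(4)]
  proof (rule nn_integral_cong_AE)
    show "AE \<theta> in lborel. ennreal (sin \<theta> ^ m) * indicator {0..pi} \<theta> * indicator X \<theta>
        = ennreal (sin \<theta> ^ m) * indicator {s..t} \<theta>"
      using AE_lborel_singleton[of s] AE_lborel_singleton[of t]
    proof eventually_elim
      case (elim \<theta>)
      have "\<theta> \<in> {s<..<t} \<longleftrightarrow> \<theta> \<in> {s..t}" using elim by auto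
      then have "\<theta> \<in> X \<inter> {0..pi} \<longleftrightarrow> \<theta> \<in> {s..t}"
        using assms by (meson IntI atLeastAtMost_iff order_trans subsetD)
      then show ?case by (auto simp: indicator_def)
    qed
  qed
  also have "\<dots> = ennreal (sin_primitive m t - sin_primitive m s)"
    using assms(1-3)
    by (intro nn_integral_FTC_Icc) (auto intro!: DERIV_sin_primitive zero_le_power sin_ge_zero)
  finally show ?thesis .
qed

lemma emeasure_polar_measure_finite: "emeasure (polar_measure m) X < \<infinity>"
proof -
  have "emeasure (polar_measure m) X \<le> emeasure (polar_measure m) (space (polar_measure m))"
    by (rule emeasure_space)
  also have "\<dots> < \<infinity>"
    by (subst emeasure_polar_measure_interval[of 0 pi]) (auto simp: polar_measure_def)
  finally show ?thesis .
qed

lemma sin_pi_minus_double_arctan: "sin (pi - 2 * arctan r) = 2 * r / (1 + r\<^sup>2)"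
proof -
  have "sin (pi - 2 * arctan r) = 2 * sin (arctan r) * cos (arctan r)"
    by (simp add: sin_diff sin_double)
  also have "\<dots> = 2 * r / (sqrt (1 + r\<^sup>2) * sqrt (1 + r\<^sup>2))"
    by (simp add: sin_arctan cos_arctan)
  finally show ?thesis by (simp add: add_nonneg_nonneg)
qed

text \<open>
The substitution \<open>\<theta> = \<pi> - 2 arctan r\<close>: here \<open>sin \<theta> = 2r / (1 + r\<^sup>2)\<close> and
\<open>d\<theta> = - 2 dr / (1 + r\<^sup>2)\<close>. The set \<open>\<theta> \<le> t\<close> is a half-line \<open>r \<ge> R\<close>, so both sides are
differences of values of the same primitive, the value at \<open>r = \<infinity>\<close> being the one at \<open>\<theta> = 0\<close>.
\<close>

lemma distr_stereographic_radius:
  "distr (density lborel (\<lambda>r. ennreal ((2 / (r\<^sup>2 + 1)) ^ Suc m * r ^ m) * indicator {0..} r))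
     borel (\<lambda>r. pi - 2 * arctan r) = polar_measure m" (is "?M = _")
proof (rule measure_eqI_atMost)
  let ?w = "\<lambda>r. (2 / (r\<^sup>2 + 1)) ^ Suc m * r ^ m"
  let ?\<theta> = "\<lambda>r. pi - 2 * arctan r"
  have pre: "?\<theta> -` {..t} \<in> sets borel" for t
    using measurable_sets_borel[of ?\<theta> borel "{..t}"] by simp
  have eq: "emeasure ?M {..t} = emeasure (polar_measure m) {..t}" for t
  proof (cases "t \<le> 0")
    case True
    have emp: "{0..} \<inter> ?\<theta> -` {..t} = {}"
    proof -
      have "t < ?\<theta> r" for r using True arctan_ubound[of r] by linarith
      then show ?thesis by (auto simp flip: not_le)
    qed
    have "emeasure ?M {..t}
        = (\<integral>\<^sup>+r. ennreal (?w r) * indicator {0..} r * indicator (?\<theta> -` {..t}) r \<partial>lborel)"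
      using pre by (subst emeasure_distr, simp, simp, subst emeasure_density) simp_all
    also have "\<dots> = (\<integral>\<^sup>+r. 0 \<partial>(lborel :: real measure))"
      using emp by (intro nn_integral_cong) (auto simp: indicator_def)
    finally have "emeasure ?M {..t} = 0" by simp
    moreover have "emeasure (polar_measure m) {..t} = 0"
      using True by (subst emeasure_polar_measure_interval[of 0 0]) auto
    ultimately show ?thesis by simp
  next
    case False
    \<comment> \<open>Truncating \<open>t\<close> at \<open>\<pi>\<close> lets \<open>R = 0\<close> account for the case that all radii are admitted.\<close>
    define s where "s = min t pi"
    define R where "R = tan ((pi - s) / 2)"
    have s: "0 < s" "s \<le> pi" using False by (auto simp: s_def)
    have R: "arctan R = (pi - s) / 2"
      unfolding R_def using s by (intro arctan_tan) auto
    have \<theta>R: "?\<theta> R = s" using R by simp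
    have "0 \<le> arctan R" unfolding R using s by simp
    then have R0: "0 \<le> R" by simp
    have "{0..} \<inter> ?\<theta> -` {..t} = {R..}"
    proof (intro set_eqI iffI)
      fix r assume r: "r \<in> {0..} \<inter> ?\<theta> -` {..t}"
      then have "0 \<le> arctan r" by simp
      then have "arctan R \<le> arctan r" using r by (auto simp: R s_def min_def)
      then show "r \<in> {R..}" by (simp add: arctan_le_iff)
    next
      fix r assume r: "r \<in> {R..}"
      then have "arctan R \<le> arctan r" by (simp add: arctan_le_iff)
      moreover have "s \<le> t" by (simp add: s_def)
      ultimately have "pi - s \<le> 2 * arctan r" "s \<le> t" using R by (simp_all add: field_simps)
      then have "?\<theta> r \<le> t" by simp
      then show "r \<in> {0..} \<inter> ?\<theta> -` {..t}" using r R0 by simp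
    qed
    then have mem: "r \<in> {0..} \<and> pi - 2 * arctan r \<le> t \<longleftrightarrow> r \<in> {R..}" for r
      by blast
    have "emeasure ?M {..t}
        = (\<integral>\<^sup>+r. ennreal (?w r) * indicator {0..} r * indicator (?\<theta> -` {..t}) r \<partial>lborel)"
      using pre by (subst emeasure_distr, simp, simp, subst emeasure_density) simp_all
    also have "\<dots> = (\<integral>\<^sup>+r. ennreal (?w r) * indicator {R..} r \<partial>lborel)"
    proof (rule nn_integral_cong)
      fix r show "ennreal (?w r) * indicator {0..} r * indicator (?\<theta> -` {..t}) r
          = ennreal (?w r) * indicator {R..} r"
        using mem[of r] by (auto simp: indicator_def)
    qed
    also have "\<dots> = ennreal (- sin_primitive m 0 - (- sin_primitive m (?\<theta> R)))"
    proof (rule nn_integral_FTC_atLeast)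
      fix r assume "R \<le> r"
      show "((\<lambda>r. - sin_primitive m (?\<theta> r)) has_real_derivative ?w r) (at r)"
      proof -
        have "?w r = (2 * r / (1 + r\<^sup>2)) ^ m * (2 / (1 + r\<^sup>2))"
          by (simp add: power_mult_distrib power_divide add.commute mult.commute mult.left_commute)
        then have w: "?w r = - (sin (?\<theta> r) ^ m * (- 2 / (1 + r\<^sup>2)))"
          by (simp only: sin_pi_minus_double_arctan)
        have d: "(?\<theta> has_real_derivative (- 2 / (1 + r\<^sup>2))) (at r)"
          by (auto intro!: derivative_eq_intros simp: field_simps)
        show ?thesis
          unfolding w by (intro DERIV_minus DERIV_chain2[OF DERIV_sin_primitive d])
      qed
      show "0 \<le> ?w r" using \<open>R \<le> r\<close> R0 by auto
    next
      have "(?\<theta> \<longlongrightarrow> pi - 2 * (pi / 2)) at_top"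
        by (intro tendsto_intros tendsto_arctan_at_top)
      then have "(?\<theta> \<longlongrightarrow> 0) at_top" by simp
      moreover have "isCont (sin_primitive m) 0"
        by (rule DERIV_isCont[OF DERIV_sin_primitive])
      ultimately have "((\<lambda>r. sin_primitive m (?\<theta> r)) \<longlongrightarrow> sin_primitive m 0) at_top"
        by (rule isCont_tendsto_compose[rotated])
      then show "((\<lambda>r. - sin_primitive m (?\<theta> r)) \<longlongrightarrow> - sin_primitive m 0) at_top"
        by (rule tendsto_minus)
    qed simp
    also have "\<dots> = emeasure (polar_measure m) {..t}"
      unfolding \<theta>R using s by (subst emeasure_polar_measure_interval[of 0 s]) (auto simp: s_def)
    finally show ?thesis .
  qed
  then show "emeasure ?M {..t} = emeasure (polar_measure m) {..t}" for t .
  show "emeasure ?M {..t} < \<infinity>" for t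
    unfolding eq by (rule emeasure_polar_measure_finite)
qed simp_all

lemma space_sphere_borel [simp]: "space sphere_borel = unit_sphere"
  by (simp add: sphere_borel_def)

lemma continuous_on_polar_angle: "continuous_on unit_sphere polar_angle"
  unfolding polar_angle_eq_arccos[abs_def]
  by (intro continuous_intros) (use snd_sphere_bounds in \<open>fastforce simp: abs_le_iff\<close>)+

lemma polar_angle_measurable [measurable]: "polar_angle \<in> borel_measurable sphere_borel"
  unfolding sphere_borel_def
  by (rule borel_measurable_continuous_on_restrict[OF continuous_on_polar_angle])

lemma fst_measurable_sphere [measurable]:
  "fst \<in> borel_measurable (sphere_borel :: ((real ^ 'n) \<times> real) measure)"
  unfolding sphere_borel_def
  by (intro measurable_restrict_space1 borel_measurable_continuous_onI continuous_intros)

lemma sphere_coords_measurable [measurable]: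
  "(sphere_coords :: (real ^ 'n) \<times> real \<Rightarrow> _) \<in> sphere_borel \<rightarrow>\<^sub>M borel \<Otimes>\<^sub>M borel"
  unfolding sphere_coords_def[abs_def] by measurable

lemma sphere_rectangle_sets:
  fixes \<Omega> :: "(real ^ 'n) set"
  assumes "X \<in> sets borel" "\<Omega> \<in> sets borel"
  shows "{x \<in> unit_sphere. polar_angle x \<in> X \<and> sgn (fst x) \<in> \<Omega>} \<in> sets sphere_borel"
proof -
  have "{x \<in> unit_sphere. polar_angle x \<in> X \<and> sgn (fst x) \<in> \<Omega>}
      = sphere_coords -` (X \<times> \<Omega>) \<inter> space sphere_borel"
    by (auto simp: sphere_coords_def)
  then show ?thesis
    using measurable_sets[OF sphere_coords_measurable pair_measureI[OF assms]] by simp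
qed

lemma sets_vol_sphere [measurable_cong, simp]: "sets vol_sphere = sets sphere_borel"
  by (simp add: vol_sphere_def)

lemma space_vol_sphere [simp]: "space vol_sphere = unit_sphere"
  by (simp add: vol_sphere_def)

lemma inv_stereographic_measurable [measurable]:
  "(inv_stereographic :: real ^ 'n \<Rightarrow> _) \<in> borel \<rightarrow>\<^sub>M sphere_borel"
  unfolding sphere_borel_def
proof (rule measurable_restrict_space2)
  show "(inv_stereographic :: real ^ 'n \<Rightarrow> _) \<in> borel \<rightarrow>\<^sub>M borel"
    by (rule borel_measurable_continuous_onI, rule continuous_at_imp_continuous_on)
       (blast intro: has_derivative_continuous inv_stereographic_has_derivative)
qed (use inv_stereographic_in_sphere in auto)

text \<open>
The product structure of the volume: its polar part does not depend on the set of directions.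
\<close>

lemma emeasure_vol_sphere_rectangle:
  fixes \<Omega> :: "(real ^ 'n) set"
  assumes [measurable]: "X \<in> sets borel" "\<Omega> \<in> sets borel"
  shows "emeasure vol_sphere {x \<in> unit_sphere. polar_angle x \<in> X \<and> sgn (fst x) \<in> \<Omega>}
       = ennreal (real CARD('n)) * cone_volume \<Omega> * emeasure (polar_measure (CARD('n) - 1)) X"
proof -
  let ?n = "CARD('n)" and ?m = "CARD('n) - 1"
  let ?S = "{x \<in> unit_sphere. polar_angle x \<in> X \<and> sgn (fst x) \<in> \<Omega>}"
  let ?\<theta> = "\<lambda>r. pi - 2 * arctan r"
  have n: "?n = Suc ?m" using zero_less_card_finite[where 'a='n] by simp
  have S [measurable]: "?S \<in> sets sphere_borel" by (rule sphere_rectangle_sets[OF assms])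
  have "emeasure vol_sphere ?S =
      (\<integral>\<^sup>+u. ennreal ((2 / ((norm u)\<^sup>2 + 1)) ^ ?n) * indicator (inv_stereographic -` ?S) u \<partial>lborel)"
    unfolding vol_sphere_def sqrt_det_metric_coeffs
    using measurable_sets[OF inv_stereographic_measurable S]
    by (subst emeasure_distr[OF _ S], simp, subst emeasure_density) simp_all
  also have "\<dots> = (\<integral>\<^sup>+u. (ennreal ((2 / ((norm u)\<^sup>2 + 1)) ^ ?n) * indicator X (?\<theta> (norm u)))
                     * indicator \<Omega> (sgn u) \<partial>lborel)"
    using inv_stereographic_in_sphere
    by (intro nn_integral_cong)
       (auto simp: indicator_def polar_angle_inv_stereographic sgn_fst_inv_stereographic)
  also have "\<dots> = cone_volume \<Omega> *
      (\<integral>\<^sup>+r. ennreal ((2 / (r\<^sup>2 + 1)) ^ ?n) * indicator X (?\<theta> r) *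
         (ennreal (real ?n * r ^ ?m) * indicator {0..} r) \<partial>lborel)"
    by (subst nn_integral_cone[where k = "\<lambda>r. ennreal ((2 / (r\<^sup>2 + 1)) ^ ?n) * indicator X (?\<theta> r)"])
       simp_all
  also have "(\<integral>\<^sup>+r. ennreal ((2 / (r\<^sup>2 + 1)) ^ ?n) * indicator X (?\<theta> r) *
         (ennreal (real ?n * r ^ ?m) * indicator {0..} r) \<partial>lborel)
      = ennreal (real ?n) *
        (\<integral>\<^sup>+r. ennreal ((2 / (r\<^sup>2 + 1)) ^ Suc ?m * r ^ ?m) * indicator {0..} r * indicator X (?\<theta> r) \<partial>lborel)"
    unfolding n[symmetric]
    by (subst nn_integral_cmult[symmetric])
       (auto intro!: nn_integral_cong simp: indicator_def ennreal_mult'[symmetric] ac_simps)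
  also have "(\<integral>\<^sup>+r. ennreal ((2 / (r\<^sup>2 + 1)) ^ Suc ?m * r ^ ?m) * indicator {0..} r * indicator X (?\<theta> r) \<partial>lborel)
      = emeasure (polar_measure ?m) X"
  proof -
    have "?\<theta> -` X \<in> sets borel"
      using measurable_sets_borel[of ?\<theta> borel X] by simp
    then show ?thesis
      unfolding distr_stereographic_radius[symmetric]
      by (subst emeasure_distr, simp, simp, subst emeasure_density)
         (auto intro!: nn_integral_cong simp: indicator_def)
  qed
  finally show ?thesis by (simp add: ac_simps)
qed

section \<open>Normalizing the mass balance\<close>

lemma interval_in_half_period:
  fixes s t :: real
  assumes "s < t" and nonneg: "\<And>x. s < x \<Longrightarrow> x < t \<Longrightarrow> 0 \<le> sin x"
  obtains k :: int where "2 * pi * of_int k \<le> s" "t \<le> 2 * pi * of_int k + pi"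
proof -
  define k where "k = \<lfloor>s / (2 * pi)\<rfloor>"
  have "of_int k \<le> s / (2 * pi)" "s / (2 * pi) < of_int k + 1"
    unfolding k_def by linarith+
  then have k: "2 * pi * of_int k \<le> s" "s < 2 * pi * of_int k + 2 * pi"
    using pi_gt_zero by (simp_all add: field_simps)
  have "t \<le> 2 * pi * of_int k + pi"
  proof (rule ccontr)
    assume t: "\<not> t \<le> 2 * pi * of_int k + pi"
    have "max s (2 * pi * of_int k + pi) < min t (2 * pi * of_int k + 2 * pi)"
      using t k assms(1) pi_gt_zero by auto
    from dense[OF this] obtain x
      where x: "s < x" "x < t" "2 * pi * of_int k + pi < x" "x < 2 * pi * of_int k + 2 * pi"
      by (auto simp only: max_less_iff_conj min_less_iff_conj)
    have "sin ((x - 2 * pi * of_int k) - pi) > 0"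
      using x by (intro sin_gt_zero) auto
    moreover have "sin (x - 2 * pi * of_int k) = sin x"
      using sin_add_2pi_int[of "x - 2 * pi * of_int k" k] by simp
    ultimately have "sin x < 0" by (simp add: sin_diff)
    then show False using nonneg[OF x(1,2)] by simp
  qed
  with k that show ?thesis by blast
qed

text \<open>
By continuity the equation extends to the end points, where it says that the primitive \<open>P\<close> takes the
same value at \<open>\<phi> a\<close> and \<open>\<beta>\<close>, and at \<open>\<phi> \<alpha>\<close> and \<open>b\<close>. For even \<open>m\<close> the primitive is
injective. For odd \<open>m\<close> the equation forces \<open>P\<close> to increase on the interval swept out by \<open>\<phi>\<close>, so
the sine is nonnegative there and the interval lies in some \<open>[2\<pi>k, 2\<pi>k + \<pi>]\<close>; after a shift by the
period \<open>2\<pi>k\<close>, injectivity on \<open>[0, \<pi>]\<close> applies.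
\<close>

lemma mass_balance_normalization:
  fixes \<phi> :: "real \<Rightarrow> real" and a \<alpha> b \<beta> :: real
  assumes ab: "0 \<le> a" "a < \<alpha>" "\<alpha> \<le> pi" "0 \<le> b" "b < \<beta>" "\<beta> \<le> pi"
    and cont: "continuous_on {a..\<alpha>} \<phi>"
    and dec: "strict_antimono_on {a..\<alpha>} \<phi>"
    and bal: "\<And>\<theta>. \<theta> \<in> {a<..<\<alpha>} \<Longrightarrow>
      (sin_primitive m \<theta> - sin_primitive m a) * (sin_primitive m \<beta> - sin_primitive m b)
      = (sin_primitive m \<beta> - sin_primitive m (\<phi> \<theta>)) * (sin_primitive m \<alpha> - sin_primitive m a)"
  obtains k :: int where
    "\<phi> a - 2 * pi * of_int k = \<beta>" "\<phi> \<alpha> - 2 * pi * of_int k = b"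
    "\<And>\<theta>. \<theta> \<in> {a..\<alpha>} \<Longrightarrow>
      (sin_primitive m \<theta> - sin_primitive m a) * (sin_primitive m \<beta> - sin_primitive m b)
      = (sin_primitive m \<beta> - sin_primitive m (\<phi> \<theta> - 2 * pi * of_int k))
        * (sin_primitive m \<alpha> - sin_primitive m a)"
proof -
  let ?P = "sin_primitive m"
  let ?VA = "?P \<alpha> - ?P a" and ?VB = "?P \<beta> - ?P b"
  have VA: "?VA > 0" and VB: "?VB > 0"
    using sin_primitive_strict_mono[of a \<alpha> m] sin_primitive_strict_mono[of b \<beta> m] ab by auto
  have bal': "(?P \<theta> - ?P a) * ?VB = (?P \<beta> - ?P (\<phi> \<theta>)) * ?VA" if "\<theta> \<in> {a..\<alpha>}" for \<theta>
  proof -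
    have cl: "closure {a<..<\<alpha>} = {a..\<alpha>}" using ab(2) by (rule closure_greaterThanLessThan)
    have "(?P \<theta> - ?P a) * ?VB - (?P \<beta> - ?P (\<phi> \<theta>)) * ?VA = 0"
    proof (rule continuous_constant_on_closure[where S = "{a<..<\<alpha>}" and x = \<theta>
          and f = "\<lambda>\<theta>. (?P \<theta> - ?P a) * ?VB - (?P \<beta> - ?P (\<phi> \<theta>)) * ?VA"])
      show "continuous_on (closure {a<..<\<alpha>})
              (\<lambda>\<theta>. (?P \<theta> - ?P a) * ?VB - (?P \<beta> - ?P (\<phi> \<theta>)) * ?VA)"
        unfolding cl
        by (intro continuous_intros continuous_on_sin_primitive cont
            continuous_on_compose2[OF continuous_on_sin_primitive[of UNIV] cont]) auto
    qed (use bal that cl in auto)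
    then show ?thesis by simp
  qed
  have end_a: "?P (\<phi> a) = ?P \<beta>" using bal'[of a] VA ab by simp
  have end_\<alpha>: "?P (\<phi> \<alpha>) = ?P b"
  proof -
    have "?VB * ?VA = (?P \<beta> - ?P (\<phi> \<alpha>)) * ?VA" using bal'[of \<alpha>] ab by (simp add: mult.commute)
    then show ?thesis using VA by simp
  qed
  show ?thesis
  proof (cases "even m")
    case True
    then have inj: "x = y" if "?P x = ?P y" for x y
      using that sin_primitive_strict_mono_even[of m x y] sin_primitive_strict_mono_even[of m y x]
      by (cases x y rule: linorder_cases) auto
    show ?thesis
      by (rule that[of 0]) (use bal' inj[OF end_a] inj[OF end_\<alpha>] in auto)
  next
    case False
    have dec': "\<phi> y < \<phi> x" if "x \<in> {a..\<alpha>}" "y \<in> {a..\<alpha>}" "x < y" for x y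
      using dec that by (auto simp: monotone_on_def)
    have surj: "\<exists>\<theta>\<in>{a..\<alpha>}. \<phi> \<theta> = t" if "t \<in> {\<phi> \<alpha>..\<phi> a}" for t
      using IVT2'[of \<phi> \<alpha> t a] that ab cont by auto
    have inc: "?P u < ?P v" if uv: "u \<in> {\<phi> \<alpha>..\<phi> a}" "v \<in> {\<phi> \<alpha>..\<phi> a}" "u < v" for u v
    proof -
      obtain x y where xy: "x \<in> {a..\<alpha>}" "\<phi> x = u" "y \<in> {a..\<alpha>}" "\<phi> y = v"
        using surj uv by metis
      have "y < x" using dec'[of x y] xy uv(3) by (cases x y rule: linorder_cases) auto
      then have "?P y < ?P x" using xy ab by (intro sin_primitive_strict_mono) auto
      then have "(?P y - ?P a) * ?VB < (?P x - ?P a) * ?VB" using VB by simp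
      then have "(?P \<beta> - ?P v) * ?VA < (?P \<beta> - ?P u) * ?VA" using bal' xy by simp
      then show ?thesis using VA by simp
    qed
    have nonneg: "0 \<le> sin x" if x: "\<phi> \<alpha> < x" "x < \<phi> a" for x
    proof (rule ccontr)
      assume "\<not> 0 \<le> sin x"
      then have "sin x ^ m < 0" using False by (simp add: power_less_zero_eq)
      from DERIV_neg_dec_right[OF DERIV_sin_primitive this]
      obtain d where d: "0 < d" "\<And>h. 0 < h \<Longrightarrow> h < d \<Longrightarrow> ?P (x + h) < ?P x" by auto
      define h where "h = min (d / 2) (\<phi> a - x)"
      have h: "0 < h" "h < d" "x + h \<le> \<phi> a" using d(1) x by (auto simp: h_def)
      have "?P x < ?P (x + h)" using h x by (intro inc) auto
      with d(2)[OF h(1,2)] show False by simp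
    qed
    obtain k :: int where k: "2 * pi * of_int k \<le> \<phi> \<alpha>" "\<phi> a \<le> 2 * pi * of_int k + pi"
      using interval_in_half_period[of "\<phi> \<alpha>" "\<phi> a"] nonneg dec'[of a \<alpha>] ab by auto
    have per: "?P (t - 2 * pi * of_int k) = ?P t" for t
      using sin_primitive_periodic_odd[OF False, of "t - 2 * pi * of_int k" k] by simp
    have lt: "\<phi> \<alpha> < \<phi> a" using dec'[of a \<alpha>] ab by auto
    have "\<phi> a - 2 * pi * of_int k = \<beta>"
      by (rule sin_primitive_inj[of _ _ m]) (use k lt ab end_a per in auto)
    moreover have "\<phi> \<alpha> - 2 * pi * of_int k = b"
      by (rule sin_primitive_inj[of _ _ m]) (use k lt ab end_\<alpha> per in auto)
    ultimately show ?thesis using bal' by (intro that[of k]) (simp_all only: per)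
  qed
qed

section \<open>Dual potentials for convex transport on the line\<close>

text \<open>
The derivative of \<open>\<bar>u\<bar>\<^sup>p\<close> away from \<open>0\<close>. For \<open>p = 1\<close> it is the sign function, whose value \<open>0\<close> at the
kink is a subgradient, so that monotonicity holds for all \<open>p \<ge> 1\<close>.
\<close>

definition abs_powr_deriv :: "real \<Rightarrow> real \<Rightarrow> real" where
  "abs_powr_deriv p u = p * sgn u * \<bar>u\<bar> powr (p - 1)"

lemma abs_powr_deriv_measurable [measurable]: "abs_powr_deriv p \<in> borel_measurable borel"
  unfolding abs_powr_deriv_def[abs_def] by measurable

lemma abs_powr_deriv_mono:
  assumes "1 \<le> p" "u \<le> v"
  shows "abs_powr_deriv p u \<le> abs_powr_deriv p v"
proof -
  have pos: "0 \<le> abs_powr_deriv p x" if "0 \<le> x" for x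
    using that assms(1) by (auto simp: abs_powr_deriv_def sgn_if)
  have neg: "abs_powr_deriv p (- x) = - abs_powr_deriv p x" for x
    by (simp add: abs_powr_deriv_def sgn_minus)
  have mono: "abs_powr_deriv p x \<le> abs_powr_deriv p y" if "0 \<le> x" "x \<le> y" for x y
    using that assms(1)
    by (auto simp: abs_powr_deriv_def sgn_if intro!: mult_left_mono powr_mono2)
  consider "0 \<le> u" | "u < 0" "0 \<le> v" | "v < 0" by linarith
  then show ?thesis
  proof cases
    case 1 then show ?thesis using mono assms(2) by simp
  next
    case 2 then show ?thesis using pos[of "- u"] pos[of v] neg[of u] by simp
  next
    case 3 then show ?thesis using mono[of "- v" "- u"] neg[of u] neg[of v] assms(2) by simp
  qed
qed

lemma DERIV_abs_powr:
  assumes "u \<noteq> (0::real)"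
  shows "((\<lambda>x. \<bar>x\<bar> powr p) has_real_derivative abs_powr_deriv p u) (at u)"
proof (cases "0 < u")
  case True
  have "((\<lambda>x. x powr p) has_real_derivative p * u powr (p - 1)) (at u)"
    by (rule has_real_derivative_powr[OF True])
  then have "((\<lambda>x. \<bar>x\<bar> powr p) has_real_derivative p * u powr (p - 1)) (at u)"
    by (rule has_field_derivative_transform_within_open[where S = "{0<..}"]) (use True in auto)
  then show ?thesis using True by (simp add: abs_powr_deriv_def)
next
  case False
  then have u: "0 < - u" using assms by simp
  have "((\<lambda>x. (- x) powr p) has_real_derivative p * (- u) powr (p - 1) * (- 1)) (at u)"
    by (rule DERIV_chain2[where f = "\<lambda>z. z powr p" and g = uminus, OF has_real_derivative_powr[OF u]]) (auto intro!: derivative_eq_intros)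
  then have "((\<lambda>x. \<bar>x\<bar> powr p) has_real_derivative p * (- u) powr (p - 1) * (- 1)) (at u)"
    by (rule has_field_derivative_transform_within_open[where S = "{..<0}"]) (use u in auto)
  then show ?thesis using u by (simp add: abs_powr_deriv_def)
qed

lemma continuous_on_abs_powr:
  fixes g :: "'a::topological_space \<Rightarrow> real"
  assumes "1 \<le> p" "continuous_on S g"
  shows "continuous_on S (\<lambda>x. \<bar>g x\<bar> powr p)"
  using assms by (intro continuous_on_powr' continuous_intros) auto

lemma abs_powr_deriv_has_integral:
  assumes "1 \<le> p" "x \<le> y"
  shows "((\<lambda>r. abs_powr_deriv p (r - t)) has_integral \<bar>y - t\<bar> powr p - \<bar>x - t\<bar> powr p) {x..y}"
proof (rule fundamental_theorem_of_calculus_interior_strong[where S = "{t}"])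
  fix r assume "r \<in> {x<..<y} - {t}"
  then have "((\<lambda>r. \<bar>r - t\<bar> powr p) has_real_derivative abs_powr_deriv p (r - t) * 1) (at r)"
    by (intro DERIV_chain2[OF DERIV_abs_powr]) (auto intro!: derivative_eq_intros)
  then show "((\<lambda>r. \<bar>r - t\<bar> powr p) has_vector_derivative abs_powr_deriv p (r - t)) (at r)"
    by (simp add: has_real_derivative_iff_has_vector_derivative)
qed (use assms in \<open>auto intro!: continuous_on_abs_powr continuous_intros\<close>)

text \<open>
Write \<open>h u = \<bar>u\<bar>\<^sup>p\<close>. First-order optimality suggests \<open>f' s = h' (s - m s)\<close>, hence
\<open>f s = \<integral> h' (r - m r) dr\<close> over \<open>[a, s]\<close>, and equality at \<open>s = \<sigma> t\<close>, with \<open>\<sigma>\<close> the inverse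
of \<open>m\<close>, dictates \<open>g t = h (\<sigma> t - t) - f (\<sigma> t)\<close>. The inequality then compares the integrals of
\<open>h' (r - m r)\<close> and \<open>h' (r - t)\<close> between \<open>\<sigma> t\<close> and \<open>s\<close>: as \<open>m\<close> is increasing, \<open>m r \<ge> t\<close>
to the right of \<open>\<sigma> t\<close> and \<open>m r \<le> t\<close> to its left, and \<open>h'\<close> is increasing. Extending \<open>\<sigma>\<close> by
constants beyond the range of \<open>m\<close> keeps this true, so the inequality holds for every real \<open>t\<close>.
\<close>

lemma monotone_dual_potentials:
  fixes m :: "real \<Rightarrow> real"
  assumes p: "1 \<le> p" and a: "a \<le> \<alpha>"
    and cont: "continuous_on {a..\<alpha>} m" and mono: "strict_mono_on {a..\<alpha>} m"
  obtains f g :: "real \<Rightarrow> real" where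
    "continuous_on UNIV f" "continuous_on UNIV g"
    "\<And>s t. s \<in> {a..\<alpha>} \<Longrightarrow> f s + g t \<le> \<bar>s - t\<bar> powr p"
    "\<And>s. s \<in> {a..\<alpha>} \<Longrightarrow> f s + g (m s) = \<bar>s - m s\<bar> powr p"
proof -
  \<comment> \<open>\<open>m\<close> is controlled on \<open>[a, \<alpha>]\<close> only; clamping the argument gives functions on the whole line.\<close>
  let ?c = "\<lambda>r. max a (min \<alpha> r)"
  define D where "D = (\<lambda>r. abs_powr_deriv p (r - m (?c r)))"
  have contc: "continuous_on UNIV (\<lambda>r. m (?c r))"
    by (intro continuous_on_compose2[OF cont]) (use a in \<open>auto intro!: continuous_intros\<close>)
  have Dm [measurable]: "D \<in> borel_measurable borel"
    using borel_measurable_continuous_onI[OF contc] unfolding D_def by measurable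
  have Dint: "D integrable_on {a..\<alpha>}"
  proof -
    have "bounded ((\<lambda>r. r - m (?c r)) ` {a..\<alpha>})"
      by (intro compact_imp_bounded compact_continuous_image continuous_intros
          continuous_on_subset[OF contc]) auto
    then obtain K where "\<forall>x\<in>(\<lambda>r. r - m (?c r)) ` {a..\<alpha>}. norm x \<le> K"
      unfolding bounded_iff by blast
    then have K: "\<bar>r - m (?c r)\<bar> \<le> K" if "r \<in> {a..\<alpha>}" for r using that by auto
    have "norm (D r) \<le> p * K powr (p - 1)" if "r \<in> {a..\<alpha>}" for r
      using K[OF that] p
      by (auto simp: D_def abs_powr_deriv_def abs_mult sgn_if intro!: mult_left_mono powr_mono2)
    then have "set_integrable lborel {a..\<alpha>} D"
      unfolding set_integrable_def
      by (intro integrableI_bounded_set_indicator[where B = "p * K powr (p - 1)"]) (use a in auto)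
    then show ?thesis by (rule set_borel_integral_eq_integral)
  qed
  have sub: "D integrable_on {x..y}" if "a \<le> x" "y \<le> \<alpha>" for x y
    using integrable_on_subinterval[OF Dint] that by auto
  define F where "F = (\<lambda>s. integral {a..s} D)"
  have Fdiff: "F y - F x = integral {x..y} D" if "a \<le> x" "x \<le> y" "y \<le> \<alpha>" for x y
    using Henstock_Kurzweil_Integration.integral_combine[where a = a and c = x and b = y and f = D] that sub[of a y] by (simp add: F_def)
  have Fcont: "continuous_on {a..\<alpha>} F"
    unfolding F_def by (rule indefinite_integral_continuous_1[OF Dint])
  have m_less: "m x < m y" if "x \<in> {a..\<alpha>}" "y \<in> {a..\<alpha>}" "x < y" for x y
    using mono that by (auto simp: monotone_on_def)
  then have inj: "inj_on m {a..\<alpha>}"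
    by (intro linorder_inj_onI) force+
  have le: "m x \<le> m y" if "x \<in> {a..\<alpha>}" "y \<in> {a..\<alpha>}" "x \<le> y" for x y
    using m_less that by (cases "x = y") force+
  have im: "m ` {a..\<alpha>} = {m a..m \<alpha>}"
  proof (intro equalityI subsetI)
    fix t assume "t \<in> {m a..m \<alpha>}"
    then show "t \<in> m ` {a..\<alpha>}" using IVT'[of m a t \<alpha>] a cont by auto
  qed (use le a in auto)
  define \<sigma> where "\<sigma> = (\<lambda>t. the_inv_into {a..\<alpha>} m (max (m a) (min (m \<alpha>) t)))"
  have ma: "m a \<le> m \<alpha>" using le a by auto
  have \<sigma>: "\<sigma> t \<in> {a..\<alpha>}" "m (\<sigma> t) = max (m a) (min (m \<alpha>) t)" for t
  proof -
    have "max (m a) (min (m \<alpha>) t) \<in> m ` {a..\<alpha>}" unfolding im using ma by auto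
    then show "\<sigma> t \<in> {a..\<alpha>}" "m (\<sigma> t) = max (m a) (min (m \<alpha>) t)"
      unfolding \<sigma>_def using the_inv_into_into[OF inj _ subset_refl] f_the_inv_into_f[OF inj] by blast+
  qed
  have \<sigma>m: "\<sigma> (m s) = s" if "s \<in> {a..\<alpha>}" for s
    using that le[of a s] le[of s \<alpha>] a by (simp add: \<sigma>_def the_inv_into_f_f[OF inj])
  have \<sigma>cont: "continuous_on UNIV \<sigma>"
  proof -
    have "continuous_on (m ` {a..\<alpha>}) (the_inv_into {a..\<alpha>} m)"
      by (rule continuous_on_inv[OF cont]) (auto simp: the_inv_into_f_f[OF inj])
    then show ?thesis
      unfolding \<sigma>_def im
      by (rule continuous_on_compose2) (use ma in \<open>auto intro!: continuous_intros\<close>)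
  qed
  define g where "g = (\<lambda>t. \<bar>\<sigma> t - t\<bar> powr p - F (\<sigma> t))"
  show ?thesis
  proof (rule that[of "\<lambda>s. F (?c s)" g])
    show "continuous_on UNIV (\<lambda>s. F (?c s))"
      by (intro continuous_on_compose2[OF Fcont]) (use a in \<open>auto intro!: continuous_intros\<close>)
    show "continuous_on UNIV g"
      unfolding g_def
      by (intro continuous_intros continuous_on_abs_powr p \<sigma>cont
          continuous_on_compose2[OF Fcont \<sigma>cont]) (use \<sigma> in auto)
    show "F (?c s) + g (m s) = \<bar>s - m s\<bar> powr p" if "s \<in> {a..\<alpha>}" for s
    proof -
      have "?c s = s" using that by auto
      then show ?thesis by (simp add: g_def \<sigma>m[OF that])
    qed
    show "F (?c s) + g t \<le> \<bar>s - t\<bar> powr p" if s: "s \<in> {a..\<alpha>}" for s t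
    proof -
      have c: "?c r = r" if "r \<in> {a..\<alpha>}" for r using that by auto
      note \<sigma>t = \<sigma>[of t]
      have "F s - F (\<sigma> t) \<le> \<bar>s - t\<bar> powr p - \<bar>\<sigma> t - t\<bar> powr p"
      proof (cases "\<sigma> t" s rule: linorder_cases)
        case less
        have "m (\<sigma> t) < m \<alpha>" using \<sigma>t s less m_less[of "\<sigma> t" \<alpha>] by auto
        then have t: "t \<le> m (\<sigma> t)" using \<sigma>t(2) by auto
        have "F s - F (\<sigma> t) = integral {\<sigma> t..s} D"
          using Fdiff[of "\<sigma> t" s] \<sigma>t s less by auto
        also have "\<dots> \<le> \<bar>s - t\<bar> powr p - \<bar>\<sigma> t - t\<bar> powr p"
        proof (rule has_integral_le[OF integrable_integral[OF sub] abs_powr_deriv_has_integral[OF p]])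
          fix r assume r: "r \<in> {\<sigma> t..s}"
          then have "m (\<sigma> t) \<le> m r" using le[of "\<sigma> t" r] \<sigma>t s by auto
          then show "D r \<le> abs_powr_deriv p (r - t)"
            unfolding D_def using r t \<sigma>t s c[of r] by (intro abs_powr_deriv_mono p) auto
        qed (use less \<sigma>t s in auto)
        finally show ?thesis .
      next
        case equal
        then show ?thesis by simp
      next
        case greater
        have "m a < m (\<sigma> t)" using \<sigma>t s greater m_less[of a "\<sigma> t"] by auto
        then have t: "m (\<sigma> t) \<le> t" using \<sigma>t(2) by auto
        have "\<bar>\<sigma> t - t\<bar> powr p - \<bar>s - t\<bar> powr p \<le> integral {s..\<sigma> t} D"
        proof (rule has_integral_le[OF abs_powr_deriv_has_integral[OF p] integrable_integral[OF sub]])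
          fix r assume r: "r \<in> {s..\<sigma> t}"
          then have "m r \<le> m (\<sigma> t)" using le[of r "\<sigma> t"] \<sigma>t s by auto
          then show "abs_powr_deriv p (r - t) \<le> D r"
            unfolding D_def using r t \<sigma>t s c[of r] by (intro abs_powr_deriv_mono p) auto
        qed (use greater \<sigma>t s in auto)
        also have "\<dots> = F (\<sigma> t) - F s"
          using Fdiff[of s "\<sigma> t"] \<sigma>t s greater by auto
        finally show ?thesis by simp
      qed
      then show ?thesis using c[OF s] by (simp add: g_def)
    qed
  qed
qed

section \<open>Transport of the polar angle\<close>

text \<open>
Both sides are measures in \<open>X\<close>. On \<open>{..t}\<close> with \<open>t = \<psi> \<theta>\<close> they become the two sides of the mass
balance at \<open>\<theta>\<close>. The total masses appear as factors rather than denominators to keep the statement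
free of division.
\<close>

lemma polar_measure_transport:
  fixes \<psi> :: "real \<Rightarrow> real"
  assumes ac: "0 \<le> a" "a < \<alpha>" "\<alpha> \<le> pi" "0 \<le> c" "c < d" "d \<le> pi"
    and cont: "continuous_on {a..\<alpha>} \<psi>" and mono: "strict_mono_on {a..\<alpha>} \<psi>"
    and ends: "\<psi> a = c" "\<psi> \<alpha> = d"
    and bal: "\<And>\<theta>. \<theta> \<in> {a..\<alpha>} \<Longrightarrow>
      (sin_primitive m \<theta> - sin_primitive m a) * (sin_primitive m d - sin_primitive m c)
      = (sin_primitive m (\<psi> \<theta>) - sin_primitive m c) * (sin_primitive m \<alpha> - sin_primitive m a)"
    and X: "X \<in> sets borel"
  shows "emeasure (polar_measure m) {\<theta> \<in> {a<..<\<alpha>}. \<psi> \<theta> \<in> X}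
           * ennreal (sin_primitive m d - sin_primitive m c)
       = emeasure (polar_measure m) (X \<inter> {c<..<d})
           * ennreal (sin_primitive m \<alpha> - sin_primitive m a)"
proof -
  let ?P = "sin_primitive m" and ?R = "polar_measure m"
  let ?I = "restrict_space ?R {a<..<\<alpha>}"
  define M where "M = density (distr ?I borel \<psi>) (\<lambda>_. ennreal (?P d - ?P c))"
  define N where "N = density ?R (\<lambda>x. ennreal (?P \<alpha> - ?P a) * indicator {c<..<d} x)"
  have VA: "?P \<alpha> - ?P a \<ge> 0" and VC: "?P d - ?P c \<ge> 0"
    using sin_primitive_strict_mono[of a \<alpha> m] sin_primitive_strict_mono[of c d m] ac by auto
  have "\<psi> \<in> borel_measurable (restrict_space borel {a<..<\<alpha>})"
    by (rule borel_measurable_continuous_on_restrict) (rule continuous_on_subset[OF cont], auto)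
  moreover have "sets ?I = sets (restrict_space borel {a<..<\<alpha>})"
    by (rule sets_restrict_space_cong) simp
  ultimately have \<psi>m: "\<psi> \<in> ?I \<rightarrow>\<^sub>M borel"
    by (simp cong: measurable_cong_sets)
  have space: "space ?I = {a<..<\<alpha>}" by (simp add: space_restrict_space polar_measure_def)
  have M: "emeasure M Y = emeasure ?R {\<theta> \<in> {a<..<\<alpha>}. \<psi> \<theta> \<in> Y} * ennreal (?P d - ?P c)"
    if "Y \<in> sets borel" for Y
  proof -
    have "emeasure M Y = ennreal (?P d - ?P c) * emeasure (distr ?I borel \<psi>) Y"
      unfolding M_def using that by (subst emeasure_density_const) auto
    also have "emeasure (distr ?I borel \<psi>) Y = emeasure ?I (\<psi> -` Y \<inter> {a<..<\<alpha>})"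
      using that \<psi>m by (simp add: emeasure_distr space)
    also have "\<dots> = emeasure ?R (\<psi> -` Y \<inter> {a<..<\<alpha>})"
      by (rule emeasure_restrict_space) (auto simp: polar_measure_def)
    also have "\<psi> -` Y \<inter> {a<..<\<alpha>} = {\<theta> \<in> {a<..<\<alpha>}. \<psi> \<theta> \<in> Y}" by auto
    finally show ?thesis by (simp add: mult.commute)
  qed
  have N: "emeasure N Y = emeasure ?R (Y \<inter> {c<..<d}) * ennreal (?P \<alpha> - ?P a)"
    if "Y \<in> sets borel" for Y
  proof -
    have "emeasure N Y = (\<integral>\<^sup>+x. ennreal (?P \<alpha> - ?P a) * indicator (Y \<inter> {c<..<d}) x \<partial>?R)"
      unfolding N_def using that
      by (subst emeasure_density) (auto intro!: nn_integral_cong simp: indicator_def)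
    also have "\<dots> = ennreal (?P \<alpha> - ?P a) * emeasure ?R (Y \<inter> {c<..<d})"
      using that by (subst nn_integral_cmult_indicator) auto
    finally show ?thesis by (simp add: mult.commute)
  qed
  have less: "\<psi> x < \<psi> y" if "x \<in> {a..\<alpha>}" "y \<in> {a..\<alpha>}" "x < y" for x y
    using mono that by (auto simp: monotone_on_def)
  have le: "\<psi> x \<le> \<psi> y" if "x \<in> {a..\<alpha>}" "y \<in> {a..\<alpha>}" "x \<le> y" for x y
    using less that by (cases "x = y") force+
  have pre: "{\<theta> \<in> {a<..<\<alpha>}. \<psi> \<theta> \<in> Y} \<in> sets borel" if "Y \<in> sets borel" for Y
  proof -
    have "\<psi> -` Y \<inter> {a<..<\<alpha>} \<in> sets ?I"
      using measurable_sets[OF \<psi>m that] by (simp add: space)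
    then have "\<psi> -` Y \<inter> {a<..<\<alpha>} \<in> sets borel"
      by (auto simp: sets_restrict_space)
    moreover have "\<psi> -` Y \<inter> {a<..<\<alpha>} = {\<theta> \<in> {a<..<\<alpha>}. \<psi> \<theta> \<in> Y}" by auto
    ultimately show ?thesis by simp
  qed
  have "M = N"
  proof (rule measure_eqI_atMost)
    fix t
    show "emeasure M {..t} < \<infinity>"
      by (simp add: M ennreal_mult_less_top emeasure_polar_measure_finite[simplified])
    show "emeasure M {..t} = emeasure N {..t}"
    proof (cases "t \<le> c")
      case True
      have "c < \<psi> \<theta>" if "\<theta> \<in> {a<..<\<alpha>}" for \<theta> using less[of a \<theta>] that ends ac by auto
      then have e: "{\<theta> \<in> {a<..<\<alpha>}. \<psi> \<theta> \<in> {..t}} = {}" using True by force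
      have "emeasure M {..t} = 0" using M[of "{..t}"] unfolding e by simp
      moreover have "{..t} \<inter> {c<..<d} = {}" using True by auto
      ultimately show ?thesis by (simp add: N)
    next
      case False
      define t' where "t' = min t d"
      have t': "c < t'" "t' \<le> d" using False ac by (auto simp: t'_def)
      obtain \<theta>' where \<theta>': "a \<le> \<theta>'" "\<theta>' \<le> \<alpha>" "\<psi> \<theta>' = t'"
        using IVT'[of \<psi> a t' \<alpha>] ends t' ac cont by auto
      have "emeasure ?R {\<theta> \<in> {a<..<\<alpha>}. \<psi> \<theta> \<in> {..t}} = ennreal (?P \<theta>' - ?P a)"
      proof (rule emeasure_polar_measure_interval)
        show "{a<..<\<theta>'} \<subseteq> {\<theta> \<in> {a<..<\<alpha>}. \<psi> \<theta> \<in> {..t}}"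
          using le[of _ \<theta>'] \<theta>' t'_def by force
        show "{\<theta> \<in> {a<..<\<alpha>}. \<psi> \<theta> \<in> {..t}} \<inter> {0..pi} \<subseteq> {a..\<theta>'}"
        proof
          fix x assume x: "x \<in> {\<theta> \<in> {a<..<\<alpha>}. \<psi> \<theta> \<in> {..t}} \<inter> {0..pi}"
          have "\<not> \<theta>' < x"
          proof
            assume "\<theta>' < x"
            then have "t' < \<psi> x" using less[of \<theta>' x] \<theta>' x by auto
            moreover have "\<psi> x \<le> d" using le[of x \<alpha>] x ends by auto
            ultimately show False using x by (auto simp: t'_def min_def split: if_splits)
          qed
          then show "x \<in> {a..\<theta>'}" using x by auto
        qed
        show "{\<theta> \<in> {a<..<\<alpha>}. \<psi> \<theta> \<in> {..t}} \<in> sets borel" by (rule pre) simp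
      qed (use \<theta>' ac in auto)
      moreover have "emeasure ?R ({..t} \<inter> {c<..<d}) = ennreal (?P t' - ?P c)"
        by (rule emeasure_polar_measure_interval) (use t' ac in \<open>auto simp: t'_def\<close>)
      ultimately show ?thesis
        using bal[of \<theta>'] \<theta>' VA VC
        by (simp add: M N ennreal_mult'[symmetric] ennreal_mult''[symmetric]
            del: greaterThanLessThan_iff atMost_iff)
    qed
  qed (simp_all add: M_def N_def)
  then show ?thesis using M[OF X] N[OF X] by simp
qed

text \<open>
Rectangles in the coordinates suffice to determine a measure on the sphere, because the coordinates
are injective with the measurable left inverse \<open>meridian_point\<close>.
\<close>

lemma sphere_measure_eqI:
  fixes M N :: "((real ^ 'n) \<times> real) measure"
  assumes sets: "sets M = sets sphere_borel" "sets N = sets sphere_borel"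
    and fin: "finite_measure M"
    and eq: "\<And>X \<Omega>. X \<in> sets borel \<Longrightarrow> \<Omega> \<in> sets borel \<Longrightarrow>
      emeasure M {x \<in> unit_sphere. polar_angle x \<in> X \<and> sgn (fst x) \<in> \<Omega>}
      = emeasure N {x \<in> unit_sphere. polar_angle x \<in> X \<and> sgn (fst x) \<in> \<Omega>}"
  shows "M = N"
proof -
  have sp: "space M = unit_sphere" "space N = unit_sphere"
    using sets_eq_imp_space_eq[OF sets(1)] sets_eq_imp_space_eq[OF sets(2)] by simp_all
  have cm: "sphere_coords \<in> M \<rightarrow>\<^sub>M borel \<Otimes>\<^sub>M borel" "sphere_coords \<in> N \<rightarrow>\<^sub>M borel \<Otimes>\<^sub>M borel"
    using sphere_coords_measurable sets by (simp_all cong: measurable_cong_sets)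
  let ?B = "borel \<Otimes>\<^sub>M borel :: (real \<times> (real ^ 'n)) measure"
  let ?E = "{X \<times> \<Omega> | (X :: real set) (\<Omega> :: (real ^ 'n) set). X \<in> sets borel \<and> \<Omega> \<in> sets borel}"
  have pre: "sphere_coords -` (X \<times> \<Omega>) \<inter> unit_sphere
      = {x \<in> unit_sphere. polar_angle x \<in> X \<and> sgn (fst x) \<in> \<Omega>}" for X and \<Omega> :: "(real ^ 'n) set"
    by (auto simp: sphere_coords_def)
  have "distr M ?B sphere_coords = distr N ?B sphere_coords"
  proof (rule measure_eqI_generator_eq[where E = ?E and \<Omega> = UNIV and A = "\<lambda>_. UNIV"])
    show "Int_stable ?E" by (rule Int_stable_pair_measure_generator)
    have "sets ?B = sigma_sets UNIV ?E"
      unfolding sets_pair_measure by simp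
    then show "sets (distr M ?B sphere_coords) = sigma_sets UNIV ?E"
      "sets (distr N ?B sphere_coords) = sigma_sets UNIV ?E" by simp_all
    show "range (\<lambda>_::nat. UNIV) \<subseteq> ?E" by (auto intro!: exI[of _ UNIV])
    show "emeasure (distr M ?B sphere_coords) UNIV \<noteq> \<infinity>"
      using finite_measure.emeasure_finite[OF finite_measure.finite_measure_distr[OF fin cm(1)], of UNIV]
      by simp
    show "emeasure (distr M ?B sphere_coords) Y = emeasure (distr N ?B sphere_coords) Y"
      if Y_in: "Y \<in> ?E" for Y
    proof -
      obtain X and \<Omega> :: "(real ^ 'n) set"
        where Y: "Y = X \<times> \<Omega>" "X \<in> sets borel" "\<Omega> \<in> sets borel" using Y_in by blast
      have "Y \<in> sets ?B" using Y by auto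
      then show ?thesis
        using eq[OF Y(2,3)] cm by (simp add: emeasure_distr sp pre Y(1))
    qed
  qed auto
  then have eqd: "emeasure (distr M ?B sphere_coords) Y = emeasure (distr N ?B sphere_coords) Y" for Y
    by simp
  show ?thesis
  proof (rule measure_eqI)
    show "sets M = sets N" using sets by simp
    fix E assume "E \<in> sets M"
    then obtain E' where E': "E' \<in> sets borel" "E = E' \<inter> unit_sphere"
      using sets by (auto simp: sphere_borel_def sets_restrict_space)
    have "(\<lambda>z. meridian_point (fst z) (snd z)) \<in> ?B \<rightarrow>\<^sub>M borel"
      unfolding meridian_point_def borel_prod[symmetric] by measurable
    from measurable_sets[OF this E'(1)]
    have Y: "{z. meridian_point (fst z) (snd z) \<in> E'} \<in> sets ?B"
      by (simp add: vimage_def space_pair_measure)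
    have "sphere_coords -` {z. meridian_point (fst z) (snd z) \<in> E'} \<inter> unit_sphere = E"
    proof (rule set_eqI)
      fix x
      show "x \<in> sphere_coords -` {z. meridian_point (fst z) (snd z) \<in> E'} \<inter> unit_sphere \<longleftrightarrow> x \<in> E"
        unfolding E'(2)
        by (cases "x \<in> unit_sphere")
           (simp_all add: meridian_point_sphere_coords sphere_coords_def del: mem_sphere)
    qed
    then show "emeasure M E = emeasure N E"
      using eqd[of "{z. meridian_point (fst z) (snd z) \<in> E'}"] Y cm
      by (simp add: emeasure_distr sp)
  qed
qed

section \<open>Optimality from dual potentials\<close>

lemma pushes_forward_distr:
  fixes \<mu> :: "((real ^ 'n) \<times> real) measure"
  assumes "sets \<mu> = sets sphere_borel" "S \<in> sphere_borel \<rightarrow>\<^sub>M sphere_borel"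
  shows "pushes_forward unit_sphere S \<mu> (distr \<mu> sphere_borel S)"
  unfolding pushes_forward_def
proof (intro allI impI)
  fix h :: "(real ^ 'n) \<times> real \<Rightarrow> real"
  assume "continuous_on unit_sphere h"
  then have "h \<in> borel_measurable sphere_borel"
    unfolding sphere_borel_def by (rule borel_measurable_continuous_on_restrict)
  moreover have "S \<in> \<mu> \<rightarrow>\<^sub>M sphere_borel"
    using assms by (simp cong: measurable_cong_sets)
  ultimately have "(LINT y|distr \<mu> sphere_borel S. h y) = (LINT x|\<mu>. h (S x))"
    by (intro integral_distr)
  also have "\<dots> = (LINT x:unit_sphere|\<mu>. h (S x))"
    unfolding set_lebesgue_integral_def
    using sets_eq_imp_space_eq[OF assms(1)] by (intro Bochner_Integration.integral_cong) auto
  finally show "(LINT y|distr \<mu> sphere_borel S. h y) = (LINT x:unit_sphere|\<mu>. h (S x))" .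
qed

lemma integrable_sphere_continuous:
  fixes h :: "(real ^ 'n) \<times> real \<Rightarrow> real"
  assumes "finite_measure M" "S \<in> M \<rightarrow>\<^sub>M sphere_borel" "continuous_on unit_sphere h"
  shows "integrable M (\<lambda>x. h (S x))"
proof -
  have "bounded (h ` unit_sphere)"
    by (intro compact_imp_bounded compact_continuous_image assms(3) compact_sphere)
  then obtain K where K: "\<And>y. y \<in> unit_sphere \<Longrightarrow> norm (h y) \<le> K"
    unfolding bounded_iff by blast
  have "h \<in> borel_measurable sphere_borel"
    unfolding sphere_borel_def by (rule borel_measurable_continuous_on_restrict[OF assms(3)])
  then have m: "(\<lambda>x. h (S x)) \<in> borel_measurable M" using assms(2) by simp
  have "S x \<in> unit_sphere" if "x \<in> space M" for x
    using measurable_space[OF assms(2) that] by simp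
  then have "AE x in M. norm (h (S x)) \<le> K" using K by (intro AE_I2) blast
  then show ?thesis
    by (rule finite_measure.integrable_const_bound[OF assms(1) _ m])
qed

text \<open>
The value of a pair of potentials is the same for every transport map: only the two marginals
enter.
\<close>

lemma integral_dual_potentials:
  fixes u v :: "(real ^ 'n) \<times> real \<Rightarrow> real"
  assumes \<mu>: "borel_prob_on_sphere \<mu>"
    and S: "S \<in> sphere_borel \<rightarrow>\<^sub>M sphere_borel" and push: "pushes_forward unit_sphere S \<mu> \<nu>"
    and u: "continuous_on unit_sphere u" and v: "continuous_on unit_sphere v"
  shows "integrable \<mu> (\<lambda>x. u x + v (S x))"
    and "(LINT x|\<mu>. u x + v (S x)) = (LINT x|\<mu>. u x) + (LINT y|\<nu>. v y)"
proof -
  have sets: "sets \<mu> = sets sphere_borel" and fin: "finite_measure \<mu>"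
    using \<mu> by (auto simp: borel_prob_on_sphere_def prob_space_def)
  have S': "S \<in> \<mu> \<rightarrow>\<^sub>M sphere_borel" and id': "(\<lambda>x. x) \<in> \<mu> \<rightarrow>\<^sub>M sphere_borel"
    using S sets by (simp_all add: measurable_ident_sets cong: measurable_cong_sets)
  have iu: "integrable \<mu> u" by (rule integrable_sphere_continuous[OF fin id' u])
  have iv: "integrable \<mu> (\<lambda>x. v (S x))" by (rule integrable_sphere_continuous[OF fin S' v])
  show "integrable \<mu> (\<lambda>x. u x + v (S x))" using iu iv by simp
  have "bounded (v ` unit_sphere)"
    by (intro compact_imp_bounded compact_continuous_image v compact_sphere)
  then have "(LINT y|\<nu>. v y) = (LINT x:unit_sphere|\<mu>. v (S x))"
    using push v by (simp add: pushes_forward_def)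
  also have "\<dots> = (LINT x|\<mu>. v (S x))"
    unfolding set_lebesgue_integral_def
    using sets_eq_imp_space_eq[OF sets] by (intro Bochner_Integration.integral_cong) auto
  finally show "(LINT x|\<mu>. u x + v (S x)) = (LINT x|\<mu>. u x) + (LINT y|\<nu>. v y)"
    using iu iv by simp
qed

lemma transport_cost_unit_sphere:
  fixes \<mu> :: "((real ^ 'n) \<times> real) measure"
  assumes "sets \<mu> = sets sphere_borel"
  shows "transport_cost p \<mu> unit_sphere S = (\<integral>\<^sup>+x. ennreal (sphere_dist x (S x) powr p) \<partial>\<mu>)"
  unfolding transport_cost_def
  using sets_eq_imp_space_eq[OF assms] by (intro nn_integral_cong) auto

lemma transport_cost_ge_dual:
  fixes u v :: "(real ^ 'n) \<times> real \<Rightarrow> real"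
  assumes \<mu>: "borel_prob_on_sphere \<mu>"
    and S: "S \<in> sphere_borel \<rightarrow>\<^sub>M sphere_borel" and push: "pushes_forward unit_sphere S \<mu> \<nu>"
    and u: "continuous_on unit_sphere u" and v: "continuous_on unit_sphere v"
    and le: "AE x in \<mu>. u x + v (S x) \<le> sphere_dist x (S x) powr p"
  shows "ennreal ((LINT x|\<mu>. u x) + (LINT y|\<nu>. v y)) \<le> transport_cost p \<mu> unit_sphere S"
proof -
  have sets: "sets \<mu> = sets sphere_borel"
    using \<mu> by (auto simp: borel_prob_on_sphere_def)
  note int = integral_dual_potentials[OF \<mu> S push u v]
  have int': "integrable \<mu> (\<lambda>x. max 0 (u x + v (S x)))" using int(1) by simp
  have "ennreal ((LINT x|\<mu>. u x) + (LINT y|\<nu>. v y)) \<le> ennreal (LINT x|\<mu>. max 0 (u x + v (S x)))"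
    unfolding int(2)[symmetric]
    by (intro ennreal_leI integral_mono int(1) int') simp
  also have "\<dots> = (\<integral>\<^sup>+x. ennreal (max 0 (u x + v (S x))) \<partial>\<mu>)"
    by (rule nn_integral_eq_integral[symmetric, OF int']) simp
  also have "\<dots> \<le> (\<integral>\<^sup>+x. ennreal (sphere_dist x (S x) powr p) \<partial>\<mu>)"
    using le by (intro nn_integral_mono_AE) (auto intro: ennreal_leI elim!: eventually_mono)
  finally show ?thesis by (simp add: transport_cost_unit_sphere[OF sets])
qed

lemma transport_cost_eq_dual:
  fixes u v :: "(real ^ 'n) \<times> real \<Rightarrow> real"
  assumes \<mu>: "borel_prob_on_sphere \<mu>"
    and S: "S \<in> sphere_borel \<rightarrow>\<^sub>M sphere_borel" and push: "pushes_forward unit_sphere S \<mu> \<nu>"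
    and u: "continuous_on unit_sphere u" and v: "continuous_on unit_sphere v"
    and eq: "AE x in \<mu>. u x + v (S x) = sphere_dist x (S x) powr p"
  shows "transport_cost p \<mu> unit_sphere S = ennreal ((LINT x|\<mu>. u x) + (LINT y|\<nu>. v y))"
proof -
  have sets: "sets \<mu> = sets sphere_borel"
    using \<mu> by (auto simp: borel_prob_on_sphere_def)
  note int = integral_dual_potentials[OF \<mu> S push u v]
  have "(\<integral>\<^sup>+x. ennreal (sphere_dist x (S x) powr p) \<partial>\<mu>) = (\<integral>\<^sup>+x. ennreal (u x + v (S x)) \<partial>\<mu>)"
    using eq by (intro nn_integral_cong_AE) (auto elim!: eventually_mono)
  also have "\<dots> = ennreal (LINT x|\<mu>. u x + v (S x))"
    using eq by (intro nn_integral_eq_integral int(1)) (auto elim!: eventually_mono)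
  finally show ?thesis by (simp add: transport_cost_unit_sphere[OF sets] int(2))
qed

text \<open>
The easy half of Kantorovich duality. The map \<open>T\<close> lives on \<open>E\<close> only, whereas the competitors are
defined on the whole sphere; \<open>S\<close> is an extension of \<open>T\<close> that is itself a competitor, which shows that
the infimum is attained.
\<close>

lemma optimal_transport_map_by_duality:
  fixes u v :: "(real ^ 'n) \<times> real \<Rightarrow> real"
  assumes \<mu>: "borel_prob_on_sphere \<mu>" and \<nu>: "borel_prob_on_sphere \<nu>"
    and E: "E \<in> sets sphere_borel" "emeasure \<mu> E = 1"
    and S: "S \<in> sphere_borel \<rightarrow>\<^sub>M sphere_borel" and push: "distr \<mu> sphere_borel S = \<nu>"
    and T: "\<And>x. x \<in> E \<Longrightarrow> T x = S x"
    and u: "continuous_on unit_sphere u" and v: "continuous_on unit_sphere v"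
    and le: "\<And>x y. x \<in> E \<Longrightarrow> y \<in> unit_sphere \<Longrightarrow> u x + v y \<le> sphere_dist x y powr p"
    and eq: "\<And>x. x \<in> E \<Longrightarrow> u x + v (S x) = sphere_dist x (S x) powr p"
  shows "optimal_transport_map p \<mu> \<nu> E T"
proof -
  let ?V = "(LINT x|\<mu>. u x) + (LINT y|\<nu>. v y)"
  have sets: "sets \<mu> = sets sphere_borel" and prob: "prob_space \<mu>"
    using \<mu> by (auto simp: borel_prob_on_sphere_def)
  have space: "space \<mu> = unit_sphere"
    using sets_eq_imp_space_eq[OF sets] by simp
  have E': "E \<in> sets \<mu>" using E sets by simp
  have EU: "E \<subseteq> unit_sphere" using sets.sets_into_space[OF E'] space by simp
  have AE: "AE x in \<mu>. x \<in> E"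
    using prob_space.AE_in_set_eq_1[OF prob E'] E(2) by (simp add: measure_def)
  have pushS: "pushes_forward unit_sphere S \<mu> \<nu>"
    using pushes_forward_distr[OF sets S] push by simp
  have pushT: "pushes_forward E T \<mu> \<nu>"
    unfolding pushes_forward_def
  proof (intro allI impI)
    fix h :: "(real ^ 'n) \<times> real \<Rightarrow> real"
    assume h: "continuous_on unit_sphere h" "bounded (h ` unit_sphere)"
    have hm: "h \<in> borel_measurable sphere_borel"
      unfolding sphere_borel_def by (rule borel_measurable_continuous_on_restrict[OF h(1)])
    have hS: "(\<lambda>x. h (S x)) \<in> borel_measurable \<mu>"
      using measurable_compose[OF S hm] sets by (simp cong: measurable_cong_sets)
    have "(LINT y|\<nu>. h y) = (LINT x:unit_sphere|\<mu>. h (S x))"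
      using pushS h by (simp add: pushes_forward_def)
    also have "\<dots> = (LINT x:E|\<mu>. h (S x))"
      unfolding set_lebesgue_integral_def
    proof (rule integral_cong_AE)
      have "unit_sphere \<in> sets \<mu>" using sets.top[of \<mu>] space by simp
      then show "(\<lambda>x. indicat_real unit_sphere x *\<^sub>R h (S x)) \<in> borel_measurable \<mu>"
        using hS by (intro borel_measurable_scaleR borel_measurable_indicator)
      show "(\<lambda>x. indicat_real E x *\<^sub>R h (S x)) \<in> borel_measurable \<mu>"
        using hS E' by (intro borel_measurable_scaleR borel_measurable_indicator)
      show "AE x in \<mu>. indicat_real unit_sphere x *\<^sub>R h (S x) = indicat_real E x *\<^sub>R h (S x)"
        using AE by eventually_elim (use EU in \<open>auto simp: indicator_def\<close>)
    qed
    also have "\<dots> = (LINT x:E|\<mu>. h (T x))"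
      unfolding set_lebesgue_integral_def
      by (intro Bochner_Integration.integral_cong) (auto simp: indicator_def T)
    finally show "(LINT y|\<nu>. h y) = (LINT x:E|\<mu>. h (T x))" .
  qed
  have costT: "transport_cost p \<mu> E T = transport_cost p \<mu> unit_sphere S"
    unfolding transport_cost_def
  proof (rule nn_integral_cong_AE)
    show "AE x in \<mu>. ennreal (sphere_dist x (T x) powr p) * indicator E x
        = ennreal (sphere_dist x (S x) powr p) * indicator unit_sphere x"
      using AE by eventually_elim (use EU T in \<open>auto simp: indicator_def\<close>)
  qed
  have costS: "transport_cost p \<mu> unit_sphere S = ennreal ?V"
    using AE eq by (intro transport_cost_eq_dual[OF \<mu> S pushS u v]) (auto elim!: eventually_mono)
  have lower: "ennreal ?V \<le> transport_cost p \<mu> unit_sphere S'"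
    if S': "S' \<in> sphere_borel \<rightarrow>\<^sub>M sphere_borel" "pushes_forward unit_sphere S' \<mu> \<nu>" for S'
  proof (rule transport_cost_ge_dual[OF \<mu> S' u v])
    show "AE x in \<mu>. u x + v (S' x) \<le> sphere_dist x (S' x) powr p"
      using AE
    proof eventually_elim
      case (elim x)
      then have "S' x \<in> unit_sphere" using measurable_space[OF S'(1), of x] EU by auto
      then show ?case using le elim by blast
    qed
  qed
  have "transport_cost p \<mu> E T =
      Inf {transport_cost p \<mu> unit_sphere S | S.
        S \<in> sphere_borel \<rightarrow>\<^sub>M sphere_borel \<and> pushes_forward unit_sphere S \<mu> \<nu>}"
    unfolding costT
  proof (rule antisym)
    show "transport_cost p \<mu> unit_sphere S \<le> Inf {transport_cost p \<mu> unit_sphere S | S.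
        S \<in> sphere_borel \<rightarrow>\<^sub>M sphere_borel \<and> pushes_forward unit_sphere S \<mu> \<nu>}"
      unfolding costS by (rule Inf_greatest) (use lower in auto)
  qed (use S pushS in \<open>blast intro: Inf_lower\<close>)
  moreover have "T \<in> restrict_space sphere_borel E \<rightarrow>\<^sub>M sphere_borel"
  proof -
    have "S \<in> restrict_space sphere_borel E \<rightarrow>\<^sub>M sphere_borel"
      by (rule measurable_restrict_space1[OF S])
    then show ?thesis
      by (subst measurable_cong[where g = S]) (auto simp: space_restrict_space T)
  qed
  ultimately show ?thesis
    using \<mu> \<nu> E pushT by (simp add: optimal_transport_map_def)
qed

section \<open>Zones and the monotone map between them\<close>

definition sphere_zone :: "real \<Rightarrow> real \<Rightarrow> ((real ^ 'n) \<times> real) set" where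
  "sphere_zone s t = {x \<in> unit_sphere. polar_angle x \<in> {s<..<t}}"

lemma sphere_zone_sets: "sphere_zone s t \<in> sets sphere_borel"
  using sphere_rectangle_sets[of "{s<..<t}" UNIV] by (simp add: sphere_zone_def)

lemma emeasure_sphere_zone:
  assumes "0 \<le> s" "s \<le> t" "t \<le> pi"
  shows "emeasure vol_sphere (sphere_zone s t :: ((real ^ 'n) \<times> real) set)
    = ennreal (real CARD('n)) * cone_volume (UNIV :: (real ^ 'n) set)
      * ennreal (sin_primitive (CARD('n) - 1) t - sin_primitive (CARD('n) - 1) s)"
proof -
  have "emeasure (polar_measure (CARD('n) - 1)) {s<..<t}
      = ennreal (sin_primitive (CARD('n) - 1) t - sin_primitive (CARD('n) - 1) s)"
    by (rule emeasure_polar_measure_interval) (use assms in auto)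
  then show ?thesis
    using emeasure_vol_sphere_rectangle[of "{s<..<t}" "UNIV :: (real ^ 'n) set"]
    by (simp add: sphere_zone_def)
qed

lemma emeasure_sphere_zone_scaled:
  "\<exists>K>0. \<forall>s t. 0 \<le> s \<longrightarrow> s \<le> t \<longrightarrow> t \<le> pi \<longrightarrow>
    emeasure vol_sphere (sphere_zone s t :: ((real ^ 'n) \<times> real) set)
      = ennreal (K * (sin_primitive (CARD('n) - 1) t - sin_primitive (CARD('n) - 1) s))"
proof -
  define c where "c = enn2real (cone_volume (UNIV :: (real ^ 'n) set))"
  have c: "cone_volume (UNIV :: (real ^ 'n) set) = ennreal c" "0 < c"
    using cone_volume_finite[of "UNIV :: (real ^ 'n) set"]
      cone_volume_UNIV_pos[where 'a = "real ^ 'n"]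
    by (auto simp: c_def enn2real_positive_iff less_top)
  show ?thesis
    by (rule exI[of _ "real CARD('n) * c"])
       (use c in \<open>auto simp: emeasure_sphere_zone ennreal_mult'\<close>)
qed

lemma borel_prob_on_sphere_uniform_zone:
  assumes "0 \<le> s" "s < t" "t \<le> pi"
  shows "borel_prob_on_sphere
    (uniform_measure vol_sphere (sphere_zone s t :: ((real ^ 'n) \<times> real) set))"
proof -
  obtain K where "0 < K" and K: "\<And>s t. 0 \<le> s \<Longrightarrow> s \<le> t \<Longrightarrow> t \<le> pi \<Longrightarrow>
    emeasure vol_sphere (sphere_zone s t :: ((real ^ 'n) \<times> real) set)
      = ennreal (K * (sin_primitive (CARD('n) - 1) t - sin_primitive (CARD('n) - 1) s))"
    using emeasure_sphere_zone_scaled[where 'n = 'n] by blast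
  then have "emeasure vol_sphere (sphere_zone s t :: ((real ^ 'n) \<times> real) set) \<notin> {0, \<infinity>}"
    using sin_primitive_strict_mono[OF assms, of "CARD('n) - 1"] assms
    by (auto simp: K ennreal_eq_0_iff not_le)
  then have "prob_space (uniform_measure vol_sphere (sphere_zone s t :: ((real ^ 'n) \<times> real) set))"
    by (intro prob_space_uniform_measure) auto
  then show ?thesis by (simp add: borel_prob_on_sphere_def)
qed

text \<open>
The value outside the zone is an arbitrary point of the sphere.
\<close>

definition zone_map :: "real \<Rightarrow> real \<Rightarrow> (real \<Rightarrow> real) \<Rightarrow> (real ^ 'n) \<times> real \<Rightarrow> (real ^ 'n) \<times> real" where
  "zone_map a \<alpha> \<psi> x = (if polar_angle x \<in> {a<..<\<alpha>}
     then meridian_point (\<psi> (polar_angle x)) (sgn (fst x)) else e_last)"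

lemma fst_nonzero_zone:
  assumes "x \<in> unit_sphere" "0 < polar_angle x" "polar_angle x < pi"
  shows "norm (sgn (fst x)) = 1"
  using norm_fst_sphere[OF assms(1)] sin_gt_zero[OF assms(2,3)]
  by (auto simp: norm_sgn)

lemma zone_map_measurable:
  assumes "0 \<le> a" "a \<le> \<alpha>" "\<alpha> \<le> pi" and cont: "continuous_on {a..\<alpha>} \<psi>"
  shows "(zone_map a \<alpha> \<psi> :: (real ^ 'n) \<times> real \<Rightarrow> _) \<in> sphere_borel \<rightarrow>\<^sub>M sphere_borel"
proof -
  let ?\<psi> = "\<lambda>r. \<psi> (max a (min \<alpha> r))"
  define sn where "sn = (\<lambda>r. sin (?\<psi> r))"
  define cs where "cs = (\<lambda>r. cos (?\<psi> r))"
  have c: "continuous_on UNIV ?\<psi>"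
    by (intro continuous_on_compose2[OF cont]) (use assms in \<open>auto intro!: continuous_intros\<close>)
  have [measurable]: "sn \<in> borel_measurable borel" "cs \<in> borel_measurable borel"
    unfolding sn_def cs_def by (intro borel_measurable_continuous_onI continuous_intros c)+
  have [measurable]: "{x \<in> space sphere_borel. polar_angle x \<in> {a<..<\<alpha>}}
      \<in> sets (sphere_borel :: ((real ^ 'n) \<times> real) measure)"
    using sphere_zone_sets[of a \<alpha>] by (simp add: sphere_zone_def)
  have eq: "zone_map a \<alpha> \<psi> = (\<lambda>x :: (real ^ 'n) \<times> real. if polar_angle x \<in> {a<..<\<alpha>}
      then (sn (polar_angle x) *\<^sub>R sgn (fst x), cs (polar_angle x)) else e_last)"
    by (auto simp: zone_map_def meridian_point_def fun_eq_iff sn_def cs_def)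
  have "(zone_map a \<alpha> \<psi> :: (real ^ 'n) \<times> real \<Rightarrow> _) \<in> sphere_borel \<rightarrow>\<^sub>M borel"
    unfolding eq
    by (intro measurable_If borel_measurable_Pair borel_measurable_scaleR) measurable
  moreover have "zone_map a \<alpha> \<psi> x \<in> unit_sphere" if "x \<in> unit_sphere" for x :: "(real ^ 'n) \<times> real"
  proof (cases "polar_angle x \<in> {a<..<\<alpha>}")
    case True
    then have "norm (sgn (fst x)) = 1" using that assms by (intro fst_nonzero_zone) auto
    then show ?thesis
      using True meridian_point_in_sphere[of "sgn (fst x)"] by (simp add: zone_map_def)
  qed (auto simp: zone_map_def e_last_def norm_Pair)
  ultimately show ?thesis
    by (subst sphere_borel_def) (auto intro!: measurable_restrict_space2)
qed

lemma normalized_eq_iff: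
  fixes K :: real
  assumes "0 < K" "0 < v" "0 < w"
  shows "x / (K * v) = y / (K * w) \<longleftrightarrow> x * w = y * v"
proof -
  have "x / (K * v) = y / (K * w) \<longleftrightarrow> x * (K * w) = y * (K * v)"
    using assms by (simp add: frac_eq_eq)
  also have "\<dots> \<longleftrightarrow> K * (x * w) = K * (y * v)" by (simp add: ac_simps)
  also have "\<dots> \<longleftrightarrow> x * w = y * v" using assms by simp
  finally show ?thesis .
qed

text \<open>
On a rectangle of coordinates, the two measures have a common factor, which depends on the directions;
what remains is a polar measure divided by the volume of the zone, and after cross-multiplication
the two quotients are compared by \<open>polar_measure_transport\<close>.
\<close>

lemma distr_zone_map:
  fixes \<psi> :: "real \<Rightarrow> real"
  defines "P \<equiv> sin_primitive (CARD('n) - 1)"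
  assumes ac: "0 \<le> a" "a < \<alpha>" "\<alpha> \<le> pi" "0 \<le> c" "c < d" "d \<le> pi"
    and cont: "continuous_on {a..\<alpha>} \<psi>" and mono: "strict_mono_on {a..\<alpha>} \<psi>"
    and ends: "\<psi> a = c" "\<psi> \<alpha> = d"
    and bal: "\<And>\<theta>. \<theta> \<in> {a..\<alpha>} \<Longrightarrow> (P \<theta> - P a) * (P d - P c) = (P (\<psi> \<theta>) - P c) * (P \<alpha> - P a)"
  shows "distr (uniform_measure vol_sphere (sphere_zone a \<alpha>)) sphere_borel (zone_map a \<alpha> \<psi>)
       = uniform_measure vol_sphere (sphere_zone c d :: ((real ^ 'n) \<times> real) set)"
    (is "distr ?\<mu> _ ?T = ?\<nu>")
proof (rule sphere_measure_eqI)
  have \<mu>: "borel_prob_on_sphere ?\<mu>" and \<nu>: "borel_prob_on_sphere ?\<nu>"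
    using ac by (auto intro!: borel_prob_on_sphere_uniform_zone)
  have T: "?T \<in> sphere_borel \<rightarrow>\<^sub>M sphere_borel"
    using ac cont by (intro zone_map_measurable) auto
  have T': "?T \<in> ?\<mu> \<rightarrow>\<^sub>M sphere_borel"
    using T by (simp cong: measurable_cong_sets)
  show "sets (distr ?\<mu> sphere_borel ?T) = sets sphere_borel" "sets ?\<nu> = sets sphere_borel"
    by simp_all
  have "prob_space (distr ?\<mu> sphere_borel ?T)"
    using \<mu> T' by (intro prob_space.prob_space_distr) (auto simp: borel_prob_on_sphere_def)
  then show "finite_measure (distr ?\<mu> sphere_borel ?T)" by (rule prob_space.finite_measure)
  fix X :: "real set" and \<Omega> :: "(real ^ 'n) set"
  assume X: "X \<in> sets borel" and \<Omega>: "\<Omega> \<in> sets borel"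
  let ?S = "{x \<in> unit_sphere. polar_angle x \<in> X \<and> sgn (fst x) \<in> \<Omega>}"
  let ?R = "polar_measure (CARD('n) - 1)"
  let ?Y = "{\<theta> \<in> {a<..<\<alpha>}. \<psi> \<theta> \<in> X}"
  have S: "?S \<in> sets sphere_borel" by (rule sphere_rectangle_sets[OF X \<Omega>])
  have less: "\<psi> x < \<psi> y" if "x \<in> {a..\<alpha>}" "y \<in> {a..\<alpha>}" "x < y" for x y
    using mono that by (auto simp: monotone_on_def)
  have Y: "?Y \<in> sets borel"
  proof -
    have "\<psi> \<in> borel_measurable (restrict_space borel {a<..<\<alpha>})"
      by (rule borel_measurable_continuous_on_restrict) (rule continuous_on_subset[OF cont], auto)
    from measurable_sets[OF this X] have "\<psi> -` X \<inter> {a<..<\<alpha>} \<in> sets borel"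
      by (auto simp: sets_restrict_space space_restrict_space)
    moreover have "\<psi> -` X \<inter> {a<..<\<alpha>} = ?Y" by auto
    ultimately show ?thesis by simp
  qed
  have pre: "sphere_zone a \<alpha> \<inter> (?T -` ?S \<inter> space ?\<mu>)
      = {x \<in> unit_sphere. polar_angle x \<in> ?Y \<and> sgn (fst x) \<in> \<Omega>}"
  proof -
    have "?T x \<in> ?S \<longleftrightarrow> \<psi> (polar_angle x) \<in> X \<and> sgn (fst x) \<in> \<Omega>"
      if x: "x \<in> unit_sphere" "polar_angle x \<in> {a<..<\<alpha>}" for x :: "(real ^ 'n) \<times> real"
    proof -
      have n: "norm (sgn (fst x)) = 1" using x ac by (intro fst_nonzero_zone) auto
      have "0 < \<psi> (polar_angle x)" "\<psi> (polar_angle x) < pi"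
        using less[of a "polar_angle x"] less[of "polar_angle x" \<alpha>] x ends ac by auto
      then show ?thesis
        using x n meridian_point_in_sphere[OF n]
        by (simp add: zone_map_def polar_angle_meridian_point sgn_fst_meridian_point)
    qed
    then show ?thesis by (auto simp: sphere_zone_def)
  qed
  have "emeasure (distr ?\<mu> sphere_borel ?T) ?S = emeasure ?\<mu> (?T -` ?S \<inter> space ?\<mu>)"
    by (rule emeasure_distr[OF T' S])
  also have "\<dots> = emeasure vol_sphere (sphere_zone a \<alpha> \<inter> (?T -` ?S \<inter> space ?\<mu>))
      / emeasure vol_sphere (sphere_zone a \<alpha> :: ((real ^ 'n) \<times> real) set)"
    using measurable_sets[OF T' S] by (intro emeasure_uniform_measure) (simp_all add: sphere_zone_sets)
  also have "\<dots> = ennreal (real CARD('n)) * cone_volume \<Omega> * emeasure ?R ?Y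
      / emeasure vol_sphere (sphere_zone a \<alpha> :: ((real ^ 'n) \<times> real) set)"
    unfolding pre emeasure_vol_sphere_rectangle[OF Y \<Omega>] ..
  finally have L: "emeasure (distr ?\<mu> sphere_borel ?T) ?S
      = ennreal (real CARD('n)) * cone_volume \<Omega> * emeasure ?R ?Y
        / emeasure vol_sphere (sphere_zone a \<alpha> :: ((real ^ 'n) \<times> real) set)" .
  have "emeasure ?\<nu> ?S = emeasure vol_sphere (sphere_zone c d \<inter> ?S)
      / emeasure vol_sphere (sphere_zone c d :: ((real ^ 'n) \<times> real) set)"
    using S by (intro emeasure_uniform_measure) (simp_all add: sphere_zone_sets)
  also have "sphere_zone c d \<inter> ?S
      = {x \<in> unit_sphere. polar_angle x \<in> X \<inter> {c<..<d} \<and> sgn (fst x) \<in> \<Omega>}"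
    by (auto simp: sphere_zone_def)
  also have "emeasure vol_sphere \<dots>
      = ennreal (real CARD('n)) * cone_volume \<Omega> * emeasure ?R (X \<inter> {c<..<d})"
    by (rule emeasure_vol_sphere_rectangle) (use X \<Omega> in auto)
  finally have R: "emeasure ?\<nu> ?S
      = ennreal (real CARD('n)) * cone_volume \<Omega> * emeasure ?R (X \<inter> {c<..<d})
        / emeasure vol_sphere (sphere_zone c d :: ((real ^ 'n) \<times> real) set)" .
  have pos: "P \<alpha> - P a > 0" "P d - P c > 0"
    using sin_primitive_strict_mono[of a \<alpha>] sin_primitive_strict_mono[of c d] ac
    by (auto simp: P_def)
  obtain K where K0: "0 < K" and K: "\<And>s t. 0 \<le> s \<Longrightarrow> s \<le> t \<Longrightarrow> t \<le> pi \<Longrightarrow>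
    emeasure vol_sphere (sphere_zone s t :: ((real ^ 'n) \<times> real) set) = ennreal (K * (P t - P s))"
    unfolding P_def using emeasure_sphere_zone_scaled[where 'n = 'n] by blast
  have tr: "emeasure ?R ?Y * ennreal (P d - P c) = emeasure ?R (X \<inter> {c<..<d}) * ennreal (P \<alpha> - P a)"
    unfolding P_def
    by (rule polar_measure_transport[OF ac cont mono ends bal[unfolded P_def] X])
  obtain q where q: "emeasure ?R ?Y = ennreal q" "0 \<le> q"
    using emeasure_polar_measure_finite[of "CARD('n) - 1" ?Y]
    by (cases "emeasure ?R ?Y") auto
  obtain r where r: "emeasure ?R (X \<inter> {c<..<d}) = ennreal r" "0 \<le> r"
    using emeasure_polar_measure_finite[of "CARD('n) - 1" "X \<inter> {c<..<d}"]
    by (cases "emeasure ?R (X \<inter> {c<..<d})") auto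
  obtain w where w: "cone_volume \<Omega> = ennreal w" "0 \<le> w"
    using cone_volume_finite[of \<Omega>] by (cases "cone_volume \<Omega>") auto
  have "q * (P d - P c) = r * (P \<alpha> - P a)"
    using tr pos q r by (simp add: ennreal_mult'[symmetric] ennreal_mult''[symmetric])
  then have "real CARD('n) * w * q / (K * (P \<alpha> - P a)) = real CARD('n) * w * r / (K * (P d - P c))"
    unfolding normalized_eq_iff[OF K0 pos] by (simp add: mult.assoc)
  moreover have "ennreal (real CARD('n)) * ennreal w * ennreal q = ennreal (real CARD('n) * w * q)"
    "ennreal (real CARD('n)) * ennreal w * ennreal r = ennreal (real CARD('n) * w * r)"
    using q r w by (simp_all add: ennreal_mult)
  ultimately show "emeasure (distr ?\<mu> sphere_borel ?T) ?S = emeasure ?\<nu> ?S"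
    unfolding L R q(1) r(1) w(1) using pos K0 ac q(2) r(2) w(2)
    by (simp add: K divide_ennreal)
qed

text \<open>
The potentials are functions of the polar angle. The inequality between them uses that distances
dominate differences of polar angles; equality holds along \<open>T\<close>, which stays on meridians.
\<close>

lemma monotone_zone_map_optimal:
  fixes \<psi> :: "real \<Rightarrow> real" and T :: "(real ^ 'n) \<times> real \<Rightarrow> (real ^ 'n) \<times> real"
  defines "P \<equiv> sin_primitive (CARD('n) - 1)"
  assumes p: "1 \<le> p"
    and ac: "0 \<le> a" "a < \<alpha>" "\<alpha> \<le> pi" "0 \<le> c" "c < d" "d \<le> pi"
    and cont: "continuous_on {a..\<alpha>} \<psi>" and mono: "strict_mono_on {a..\<alpha>} \<psi>"
    and ends: "\<psi> a = c" "\<psi> \<alpha> = d"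
    and bal: "\<And>\<theta>. \<theta> \<in> {a..\<alpha>} \<Longrightarrow> (P \<theta> - P a) * (P d - P c) = (P (\<psi> \<theta>) - P c) * (P \<alpha> - P a)"
    and T: "\<And>x. x \<in> sphere_zone a \<alpha> \<Longrightarrow> T x = meridian_point (\<psi> (polar_angle x)) (sgn (fst x))"
  shows "optimal_transport_map p (uniform_measure vol_sphere (sphere_zone a \<alpha>))
    (uniform_measure vol_sphere (sphere_zone c d)) (sphere_zone a \<alpha>) T"
proof -
  let ?A = "sphere_zone a \<alpha> :: ((real ^ 'n) \<times> real) set"
  obtain f g where fg: "continuous_on UNIV f" "continuous_on UNIV g"
    "\<And>s t. s \<in> {a..\<alpha>} \<Longrightarrow> f s + g t \<le> \<bar>s - t\<bar> powr p"
    "\<And>s. s \<in> {a..\<alpha>} \<Longrightarrow> f s + g (\<psi> s) = \<bar>s - \<psi> s\<bar> powr p"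
    using monotone_dual_potentials[OF p less_imp_le[OF ac(2)] cont mono] by metis
  have less: "\<psi> x < \<psi> y" if "x \<in> {a..\<alpha>}" "y \<in> {a..\<alpha>}" "x < y" for x y
    using mono that by (auto simp: monotone_on_def)
  have A: "x \<in> unit_sphere" "polar_angle x \<in> {a<..<\<alpha>}" if "x \<in> ?A" for x
    using that by (auto simp: sphere_zone_def)
  have map: "zone_map a \<alpha> \<psi> x = meridian_point (\<psi> (polar_angle x)) (sgn (fst x))" if "x \<in> ?A" for x
    using A[OF that] by (simp add: zone_map_def)
  have \<mu>: "borel_prob_on_sphere (uniform_measure vol_sphere ?A)"
    using ac by (intro borel_prob_on_sphere_uniform_zone) auto
  show ?thesis
  proof (rule optimal_transport_map_by_duality[where S = "zone_map a \<alpha> \<psi>"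
        and u = "\<lambda>x. f (polar_angle x)" and v = "\<lambda>y. g (polar_angle y)"])
    show "borel_prob_on_sphere (uniform_measure vol_sphere ?A)" by (rule \<mu>)
    show "borel_prob_on_sphere (uniform_measure vol_sphere (sphere_zone c d :: ((real ^ 'n) \<times> real) set))"
      using ac by (intro borel_prob_on_sphere_uniform_zone) auto
    show "?A \<in> sets sphere_borel" by (rule sphere_zone_sets)
    show "emeasure (uniform_measure vol_sphere ?A) ?A = 1"
    proof -
      have "AE x in uniform_measure vol_sphere ?A. x \<in> ?A"
        by (rule AE_uniform_measureI) (simp_all add: sphere_zone_sets)
      then show ?thesis
        using \<mu> by (intro prob_space.emeasure_eq_1_AE) (auto simp: borel_prob_on_sphere_def sphere_zone_sets)
    qed
    show "zone_map a \<alpha> \<psi> \<in> sphere_borel \<rightarrow>\<^sub>M sphere_borel"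
      using ac cont by (intro zone_map_measurable) auto
    show "distr (uniform_measure vol_sphere ?A) sphere_borel (zone_map a \<alpha> \<psi>)
        = uniform_measure vol_sphere (sphere_zone c d)"
      using bal unfolding P_def by (intro distr_zone_map[OF ac cont mono ends]) auto
    show "T x = zone_map a \<alpha> \<psi> x" if "x \<in> ?A" for x using T map that by simp
    show "continuous_on unit_sphere (\<lambda>x :: (real ^ 'n) \<times> real. f (polar_angle x))"
      by (rule continuous_on_compose2[OF fg(1) continuous_on_polar_angle]) simp
    show "continuous_on unit_sphere (\<lambda>x :: (real ^ 'n) \<times> real. g (polar_angle x))"
      by (rule continuous_on_compose2[OF fg(2) continuous_on_polar_angle]) simp
    fix x :: "(real ^ 'n) \<times> real" assume x: "x \<in> ?A"
    show "f (polar_angle x) + g (polar_angle y) \<le> sphere_dist x y powr p"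
      if "y \<in> unit_sphere" for y
    proof -
      have "f (polar_angle x) + g (polar_angle y) \<le> \<bar>polar_angle x - polar_angle y\<bar> powr p"
        using A[OF x] by (intro fg(3)) auto
      also have "\<dots> \<le> sphere_dist x y powr p"
        using polar_angle_diff_le_sphere_dist[OF A(1)[OF x] that] p by (intro powr_mono2) auto
      finally show ?thesis .
    qed
    show "f (polar_angle x) + g (polar_angle (zone_map a \<alpha> \<psi> x)) = sphere_dist x (zone_map a \<alpha> \<psi> x) powr p"
    proof -
      let ?\<theta> = "polar_angle x" and ?\<omega> = "sgn (fst x)"
      have \<theta>: "?\<theta> \<in> {a<..<\<alpha>}" using A[OF x] by simp
      have n: "norm ?\<omega> = 1" using A[OF x] ac by (intro fst_nonzero_zone) auto
      have r: "\<psi> ?\<theta> \<in> {0..pi}" "?\<theta> \<in> {0..pi}"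
        using less[of a ?\<theta>] less[of ?\<theta> \<alpha>] \<theta> ends ac by auto
      have "sphere_dist x (zone_map a \<alpha> \<psi> x) = \<bar>?\<theta> - \<psi> ?\<theta>\<bar>"
        using sphere_dist_meridian[OF n r(2,1)]
        by (simp add: map[OF x] meridian_point_sphere_coords[OF A(1)[OF x]])
      moreover have "polar_angle (zone_map a \<alpha> \<psi> x) = \<psi> ?\<theta>"
        using r by (simp add: map[OF x] polar_angle_meridian_point)
      ultimately show ?thesis using fg(4)[of ?\<theta>] \<theta> by simp
    qed
  qed
qed

theorem mainTheorem1:
  fixes p a b \<alpha> \<beta> :: real
    and A B :: "((real ^ 'n) \<times> real) set"
    and \<mu> \<nu> :: "((real ^ 'n) \<times> real) measure"
    and \<phi> :: "real \<Rightarrow> real"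
    and T :: "(real ^ 'n) \<times> real \<Rightarrow> (real ^ 'n) \<times> real"
  assumes "1 \<le> p"
    and "a \<in> {0..pi}" and "b \<in> {0..pi}" and "\<alpha> \<in> {0..pi}" and "\<beta> \<in> {0..pi}"
    and "a < \<alpha>" and "b < \<beta>"
    and "A = {x \<in> unit_sphere. sphere_dist x e_last \<in> {a<..<\<alpha>}}"
    and "\<mu> = uniform_measure vol_sphere A"
    and "B = {y \<in> unit_sphere. sphere_dist y (- e_last) \<in> {b<..<\<beta>}}"
    and "\<nu> = uniform_measure vol_sphere B"
    and "continuous_on {a..\<alpha>} \<phi>"
    and "smooth_on_open {a<..<\<alpha>} \<phi>"
    and "strict_antimono_on {a..\<alpha>} \<phi>"
    and "\<And>\<theta>. \<theta> \<in> {a<..<\<alpha>} \<Longrightarrow>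
           1 / measure vol_sphere A * (LBINT r=a..\<theta>. sin r ^ (CARD('n) - 1))
             = 1 / measure vol_sphere B * (LBINT r=\<phi> \<theta>..\<beta>. sin r ^ (CARD('n) - 1))"
    and "\<And>x. x \<in> A \<Longrightarrow>
           T x = (sin (\<phi> (polar_angle x)) / sin (polar_angle x)) *\<^sub>R perp x
                   - cos (\<phi> (polar_angle x)) *\<^sub>R e_last"
  shows "optimal_transport_map p \<mu> \<nu> A T"
proof -
  let ?P = "sin_primitive (CARD('n) - 1)"
  have ab: "0 \<le> a" "a < \<alpha>" "\<alpha> \<le> pi" "0 \<le> b" "b < \<beta>" "\<beta> \<le> pi" using assms by auto
  have A: "A = sphere_zone a \<alpha>"
    unfolding assms(8) sphere_zone_def sphere_dist_def polar_angle_def ..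
  have B: "B = sphere_zone (pi - \<beta>) (pi - b)"
    unfolding assms(10) sphere_zone_def
  proof (rule Collect_cong)
    fix y :: "(real ^ 'n) \<times> real"
    show "y \<in> unit_sphere \<and> sphere_dist y (- e_last) \<in> {b<..<\<beta>} \<longleftrightarrow>
        y \<in> unit_sphere \<and> polar_angle y \<in> {pi - \<beta><..<pi - b}"
      by (cases "y \<in> unit_sphere") (auto simp: sphere_dist_uminus_e_last simp del: mem_sphere)
  qed
  have pos: "?P \<alpha> - ?P a > 0" "?P \<beta> - ?P b > 0"
    using sin_primitive_strict_mono[of a \<alpha>] sin_primitive_strict_mono[of b \<beta>] ab by auto
  obtain K where K0: "0 < K" and K: "\<And>s t. 0 \<le> s \<Longrightarrow> s \<le> t \<Longrightarrow> t \<le> pi \<Longrightarrow>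
    emeasure vol_sphere (sphere_zone s t :: ((real ^ 'n) \<times> real) set) = ennreal (K * (?P t - ?P s))"
    using emeasure_sphere_zone_scaled[where 'n = 'n] by blast
  have volA: "measure vol_sphere A = K * (?P \<alpha> - ?P a)"
    using ab pos K0 by (simp add: A measure_def K)
  have volB: "measure vol_sphere B = K * (?P \<beta> - ?P b)"
    using ab pos K0 by (simp add: B measure_def K sin_primitive_pi_minus)
  have bal: "(?P \<theta> - ?P a) * (?P \<beta> - ?P b) = (?P \<beta> - ?P (\<phi> \<theta>)) * (?P \<alpha> - ?P a)"
    if "\<theta> \<in> {a<..<\<alpha>}" for \<theta>
    using assms(15)[OF that] normalized_eq_iff[OF K0 pos]
    unfolding volA volB LBINT_sin_power by simp
  obtain k :: int where k: "\<phi> a - 2 * pi * of_int k = \<beta>" "\<phi> \<alpha> - 2 * pi * of_int k = b"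
    and bal': "\<And>\<theta>. \<theta> \<in> {a..\<alpha>} \<Longrightarrow> (?P \<theta> - ?P a) * (?P \<beta> - ?P b)
      = (?P \<beta> - ?P (\<phi> \<theta> - 2 * pi * of_int k)) * (?P \<alpha> - ?P a)"
    using mass_balance_normalization[OF ab assms(12,14) bal] by blast
  \<comment> \<open>\<open>B\<close> is described by distances from the south pole, which are \<open>\<pi>\<close> minus the polar angle.\<close>
  define \<psi> where "\<psi> = (\<lambda>\<theta>. pi - (\<phi> \<theta> - 2 * pi * of_int k))"
  have sin\<phi>: "sin (\<phi> \<theta>) = sin (\<psi> \<theta>)" and cos\<phi>: "cos (\<phi> \<theta>) = - cos (\<psi> \<theta>)" for \<theta>
    using sin_add_2pi_int[of "\<phi> \<theta> - 2 * pi * of_int k" k]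
      cos_add_2pi_int[of "\<phi> \<theta> - 2 * pi * of_int k" k]
    by (simp_all add: \<psi>_def)
  show ?thesis
    unfolding assms(9,11) A B
  proof (rule monotone_zone_map_optimal[where \<psi> = \<psi>])
    show "continuous_on {a..\<alpha>} \<psi>"
      unfolding \<psi>_def by (intro continuous_intros assms(12))
    show "strict_mono_on {a..\<alpha>} \<psi>"
      using assms(14) by (auto simp: monotone_on_def \<psi>_def)
    show "\<psi> a = pi - \<beta>" "\<psi> \<alpha> = pi - b" using k by (simp_all add: \<psi>_def)
    show "(?P \<theta> - ?P a) * (?P (pi - b) - ?P (pi - \<beta>)) = (?P (\<psi> \<theta>) - ?P (pi - \<beta>)) * (?P \<alpha> - ?P a)"
      if "\<theta> \<in> {a..\<alpha>}" for \<theta>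
      using bal'[OF that] unfolding \<psi>_def sin_primitive_pi_minus by simp
    show "T x = meridian_point (\<psi> (polar_angle x)) (sgn (fst x))" if x: "x \<in> sphere_zone a \<alpha>" for x
    proof -
      have "x \<in> unit_sphere" using x by (simp add: sphere_zone_def)
      then have "norm (fst x) = sin (polar_angle x)" by (rule norm_fst_sphere)
      then show ?thesis
        using assms(16)[of x] x unfolding A
        by (simp add: sin\<phi> cos\<phi> perp_eq e_last_def meridian_point_def sgn_div_norm divide_inverse_commute
            divide_inverse mult.commute)
    qed
  qed (use ab assms(1) in auto)
qed

end
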